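(* Let $\Gamma$ be a max-type gain operator on $\ell^\infty_+(\mathcal I)$. The following are equivalent: (a) there exists a path of strict decay for $\Gamma$; (b) there exists $\rho\in\mathcal K_\infty$ such that $\Sigma(\Gamma_\rho)$ is UGAS. If, in addition, Assumption A holds and there is $M>0$ with $|\mathcal I_i|\le M$ for all $i\in\mathcal I$, then (a) and (b) are also equivalent to: (c) there exists $\rho\in\mathcal K_\infty$ such that all trajectories of $\Sigma(\Gamma_\rho)$ are norm-bounded and $\Gamma_\rho$ satisfies the uniform NJI condition.
   Context: Let $\mathcal I$ be a nonempty countable index set; $\ell^\infty_+(\mathcal I)$ is the cone of nonnegative real families $s=(s_i)_{i\in\mathcal I}$ with $\|s\|:=\sup_i|s_i|<\infty$, ordered componentwise; $\mathbf 1$ is the all-ones vector. $\mathcal K$: continuous strictly increasing $\gamma:\mathbb R_+\to\mathbb R_+$ with $\gamma(0)=0$; $\mathcal K_\infty$: unbounded elements of $\mathcal K$, acting componentwise; $\mathcal{KL}$: continuous $\beta$ with $\beta(\cdot,t)\in\mathcal K$ and $\beta(r,\cdot)$ continuous strictly decreasing to $0$ for $r>0$. Max-type gain operator: for each $i$ a finite (possibly empty) $\mathcal I_i\subset\mathcal I\setminus\{i\}$; directed graph $\mathcal G$ with vertices $\mathcal I$ and edges $ji$, $j\in\mathcal I_i$; a pointwise equicontinuous family $\gamma_{ij}\in\mathcal K_\infty$ ($ji\in E(\mathcal G)$) (for all $r_0\ge0,\varepsilon>0$ there is $\delta>0$ with $|\gamma_{ij}(r)-\gamma_{ij}(r_0)|\le\varepsilon$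 whenever $|r-r_0|\le\delta$, for all edges); $\Gamma_i(s):=\max_{j\in\mathcal I_i}\gamma_{ij}(s_j)$ (interpreted as $0$ if $\mathcal I_i=\emptyset$). $\Gamma_\rho:=(\mathrm{id}+\rho)\circ\Gamma$. Assumption A: there is $\eta\in\mathcal K_\infty$ with $\gamma_{ij}\ge\eta$ for all $ji\in E(\mathcal G)$, and $\mathcal I_i\ne\emptyset$ for all $i$. $\mathcal N^-_i(n)$: vertices $j$ with a directed path from $j$ to $i$ of length at most $n$ ($\mathcal N^-_i(0)=\{i\}$). $\Sigma(T)$ is the system $s^{n+1}=T(s^n)$; UGAS: $\|T^n(s)\|\le\beta(\|s\|,n)$ for some $\beta\in\mathcal{KL}$. $T$ satisfies the uniform NJI condition if for all $r,\varepsilon>0$ there are $n\in\mathbb N$, $\delta>0$ such that for all $s$, $i$ with $s_i\ge\varepsilon$, $\|s\|\le r$ there is $j\in\mathcal N^-_i(n)$ with $s_j\ge\delta$ and $T_j(s)<s_j$. A path of strict decay for $\Gamma$ is a map $\sigma:\mathbb R_+\to\ell^\infty_+(\mathcal I)$ such that: (i) for some $\rho\in\mathcal K_\infty$, $\Gamma_\rho(\sigma(r))\le\sigma(r)$ for all $r\ge0$; (ii) $\varphi_{\min}(r)\mathbf 1\le\sigma(r)\le\varphi_{\max}(r)\mathbf 1$ for some $\varphi_{\min},\varphi_{\max}\in\mathcal K_\infty$; (iii) each $\sigma_i\in\mathcal K_\infty$; (iv) for each compact $K\subset(0,\infty)$ there are $0<l\le L$ with $l|r_1-r_2|\le|\sigma_i^{-1}(r_1)-\sigma_i^{-1}(r_2)|\le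 L|r_1-r_2|$ for all $r_1,r_2\in K$, $i\in\mathcal I$. *)

theory Defs
  imports "HOL-Analysis.Analysis"
begin

definition class_K :: "(real \<Rightarrow> real) \<Rightarrow> bool" where
  "class_K g \<longleftrightarrow> continuous_on {0..} g \<and> strict_mono_on {0..} g \<and> g 0 = 0"

definition class_Kinf :: "(real \<Rightarrow> real) \<Rightarrow> bool" where
  "class_Kinf g \<longleftrightarrow> class_K g \<and> (\<forall>M. \<exists>r\<ge>0. M < g r)"

definition class_KL :: "(real \<Rightarrow> real \<Rightarrow> real) \<Rightarrow> bool" where
  "class_KL b \<longleftrightarrow>
     continuous_on ({0..} \<times> {0..}) (\<lambda>(r, t). b r t) \<and>
     (\<forall>t\<ge>0. class_K (\<lambda>r. b r t)) \<and>
     (\<forall>r>0. continuous_on {0..} (b r) \<and>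
            (\<forall>t1 t2. 0 \<le> t1 \<longrightarrow> t1 < t2 \<longrightarrow> b r t2 < b r t1) \<and>
            ((b r) \<longlongrightarrow> 0) at_top)"

definition lpos :: "('i \<Rightarrow> real) \<Rightarrow> bool" where
  "lpos s \<longleftrightarrow> (\<forall>i. 0 \<le> s i) \<and> bdd_above (range (\<lambda>i. \<bar>s i\<bar>))"

definition lnorm :: "('i \<Rightarrow> real) \<Rightarrow> real" where
  "lnorm s = (SUP i. \<bar>s i\<bar>)"

text \<open>Data: for each i the finite set II i of in-neighbours (edges j->i, j in II i),
  and gains gam i j (the paper's gamma_ij).\<close>

definition max_gain_op :: "('i \<Rightarrow> 'i set) \<Rightarrow> ('i \<Rightarrow> 'i \<Rightarrow> real \<Rightarrow> real) \<Rightarrow> bool" where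
  "max_gain_op II gam \<longleftrightarrow>
     (\<forall>i. finite (II i) \<and> i \<notin> II i) \<and>
     (\<forall>i. \<forall>j\<in>II i. class_Kinf (gam i j)) \<and>
     (\<forall>r0\<ge>0. \<forall>\<epsilon>>0. \<exists>\<delta>>0. \<forall>i. \<forall>j\<in>II i. \<forall>r\<ge>0.
        \<bar>r - r0\<bar> \<le> \<delta> \<longrightarrow> \<bar>gam i j r - gam i j r0\<bar> \<le> \<epsilon>)"

definition Gam :: "('i \<Rightarrow> 'i set) \<Rightarrow> ('i \<Rightarrow> 'i \<Rightarrow> real \<Rightarrow> real) \<Rightarrow> ('i \<Rightarrow> real) \<Rightarrow> ('i \<Rightarrow> real)" where
  "Gam II gam s = (\<lambda>i. if II i = {} then 0 else Max ((\<lambda>j. gam i j (s j)) ` II i))"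

definition Gam_rho :: "('i \<Rightarrow> 'i set) \<Rightarrow> ('i \<Rightarrow> 'i \<Rightarrow> real \<Rightarrow> real) \<Rightarrow> (real \<Rightarrow> real)
    \<Rightarrow> ('i \<Rightarrow> real) \<Rightarrow> ('i \<Rightarrow> real)" where
  "Gam_rho II gam \<rho> s = (\<lambda>i. Gam II gam s i + \<rho> (Gam II gam s i))"

definition assumption_A :: "('i \<Rightarrow> 'i set) \<Rightarrow> ('i \<Rightarrow> 'i \<Rightarrow> real \<Rightarrow> real) \<Rightarrow> bool" where
  "assumption_A II gam \<longleftrightarrow>
     (\<exists>\<eta>. class_Kinf \<eta> \<and> (\<forall>i. \<forall>j\<in>II i. \<forall>r\<ge>0. \<eta> r \<le> gam i j r)) \<and>
     (\<forall>i. II i \<noteq> {})"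

fun in_nbhd :: "('i \<Rightarrow> 'i set) \<Rightarrow> 'i \<Rightarrow> nat \<Rightarrow> 'i set" where
  "in_nbhd II i 0 = {i}"
| "in_nbhd II i (Suc n) = in_nbhd II i n \<union> (\<Union>k\<in>in_nbhd II i n. II k)"

definition UGAS :: "(('i \<Rightarrow> real) \<Rightarrow> ('i \<Rightarrow> real)) \<Rightarrow> bool" where
  "UGAS T \<longleftrightarrow> (\<exists>\<beta>. class_KL \<beta> \<and>
     (\<forall>s. lpos s \<longrightarrow> (\<forall>n::nat. lnorm ((T ^^ n) s) \<le> \<beta> (lnorm s) (real n))))"

definition bounded_trajectories :: "(('i \<Rightarrow> real) \<Rightarrow> ('i \<Rightarrow> real)) \<Rightarrow> bool" where
  "bounded_trajectories T \<longleftrightarrow>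
     (\<forall>s. lpos s \<longrightarrow> (\<exists>C. \<forall>n::nat. lnorm ((T ^^ n) s) \<le> C))"

definition uniform_NJI :: "('i \<Rightarrow> 'i set) \<Rightarrow> (('i \<Rightarrow> real) \<Rightarrow> ('i \<Rightarrow> real)) \<Rightarrow> bool" where
  "uniform_NJI II T \<longleftrightarrow>
     (\<forall>r>0. \<forall>\<epsilon>>0. \<exists>n::nat. \<exists>\<delta>>0. \<forall>s i.
        lpos s \<and> \<epsilon> \<le> s i \<and> lnorm s \<le> r \<longrightarrow>
        (\<exists>j\<in>in_nbhd II i n. \<delta> \<le> s j \<and> T s j < s j))"

definition path_strict_decay :: "('i \<Rightarrow> 'i set) \<Rightarrow> ('i \<Rightarrow> 'i \<Rightarrow> real \<Rightarrow> real)
    \<Rightarrow> (real \<Rightarrow> 'i \<Rightarrow> real) \<Rightarrow> bool" where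
  "path_strict_decay II gam \<sigma> \<longleftrightarrow>
     (\<exists>\<rho>. class_Kinf \<rho> \<and> (\<forall>r\<ge>0. Gam_rho II gam \<rho> (\<sigma> r) \<le> \<sigma> r)) \<and>
     (\<exists>\<phi>min \<phi>max. class_Kinf \<phi>min \<and> class_Kinf \<phi>max \<and>
        (\<forall>r\<ge>0. \<forall>i. \<phi>min r \<le> \<sigma> r i \<and> \<sigma> r i \<le> \<phi>max r)) \<and>
     (\<forall>i. class_Kinf (\<lambda>r. \<sigma> r i)) \<and>
     (\<forall>K. compact K \<and> K \<subseteq> {0<..} \<longrightarrow>
        (\<exists>l L. 0 < l \<and> l \<le> L \<and> (\<forall>r1\<in>K. \<forall>r2\<in>K. \<forall>i.
           l * \<bar>r1 - r2\<bar> \<le> \<bar>inv_into {0..} (\<lambda>r. \<sigma> r i) r1 - inv_into {0..} (\<lambda>r. \<sigma> r i) r2\<bar> \<and>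
           \<bar>inv_into {0..} (\<lambda>r. \<sigma> r i) r1 - inv_into {0..} (\<lambda>r. \<sigma> r i) r2\<bar> \<le> L * \<bar>r1 - r2\<bar>)))"

end

(*
  (b) implies (a): let T = Gam_rho and Q(r) = sup_n T^n(r 1). Then r 1 <= Q(r) and T(Q(r)) <= Q(r),
  and by attractivity the supremum runs over finitely many n, locally uniformly in r, so the
  components of Q are locally uniformly equicontinuous on (0, oo). With rho'(x) = min(x, rho(x)/2)
  and P = max(r/2, Gam_rho'(Q)) there is a gap P + g <= Q with g of class K_oo, and every sigma
  between P and Q satisfies Gam_rho'(sigma) <= Gam_rho'(Q) <= P <= sigma. Equicontinuity leaves
  room in the gap for a uniformly locally bi-Lipschitz sigma, obtained by infimal convolution.

  (a) implies (b): the slack rho and the uniform Lipschitz bound of sigma give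
  Gam_rho'(sigma(r)) <= sigma(r - c) with c > 0 uniform for r in a compact subset of (0, oo), so
  trajectories below sigma(b) drop below sigma(a) in a uniformly bounded number of steps.

  (b) implies (c): if nothing decreases near i, then following maximising edges backwards shows
  s_i <= T^n(s)_i, which is small for large n.

  (c) implies (b): run Gam_{rho/2} from Q(R) = sup_n Gam_rho^n(R 1), which decreases monotonically.
  As long as component i is at least eps, the NJI condition for Gam_rho together with the slack
  rho/2 forces a drop by a fixed amount in some component of the neighbourhood of i. The size of
  that neighbourhood is bounded uniformly in i, so this can happen only boundedly often.
*)
theory Submission
  imports Defs
begin

section \<open>Comparison functions\<close>

text \<open>Two reductions carry every implication. The map id + rho is increasing and fixes 0, so
  it commutes with finite maxima: on nonnegative families \<open>Gam_rho\<close> is the max-type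
  operator with gains \<open>boost \<rho> gam\<close>. Hence facts are proved for a bare operator
  \<open>T\<close> and instantiated. Since \<open>T\<close> is monotone, a constant vector dominates
  every family of that norm, so UGAS becomes \<open>attractive\<close>, a statement on trajectories
  of constant vectors. Stability near 0 follows from equicontinuity of each iterate, and the KL
  function is assembled by hand.

  The max form is what yields T(Q) <= Q: each gain sees one coordinate and therefore passes through
  the supremum of a sequence that need not be monotone.

  The obstacle is the bi-Lipschitz clause. The components of Q need not have any upper or lower
  slope bound that is uniform in the index, so Q cannot serve as the path. A path is built inside
  the gap instead: half of the gap absorbs the error of a Lipschitz approximation, the other half a
  strictly increasing term common to all components.\<close>

lemma class_K_nonneg: "class_K g \<Longrightarrow> 0 \<le> r \<Longrightarrow> 0 \<le> g r"
  unfolding class_K_def by (metis atLeast_iff le_less order_refl strict_mono_onD)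

lemma class_K_pos: "class_K g \<Longrightarrow> 0 < r \<Longrightarrow> 0 < g r"
  unfolding class_K_def by (metis atLeast_iff le_less order_refl strict_mono_onD)

lemma class_K_less: "class_K g \<Longrightarrow> 0 \<le> r \<Longrightarrow> r < s \<Longrightarrow> g r < g s"
  unfolding class_K_def by (auto simp: strict_mono_on_def)

lemma class_K_mono: "class_K g \<Longrightarrow> 0 \<le> r \<Longrightarrow> r \<le> s \<Longrightarrow> g r \<le> g s"
  using class_K_less by (cases "r = s") (auto intro: less_imp_le)

lemma class_K_zero: "class_K g \<Longrightarrow> g 0 = 0"
  unfolding class_K_def by auto

lemma class_K_cont:
  assumes "class_K g" "0 \<le> r0" "0 < e"
  obtains d where "0 < d" "\<And>r. 0 \<le> r \<Longrightarrow> \<bar>r - r0\<bar> \<le> d \<Longrightarrow> \<bar>g r - g r0\<bar> \<le> e"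
proof -
  have "continuous_on {0..} g" using assms(1) class_K_def by auto
  then obtain d where d: "0 < d" "\<And>r. 0 \<le> r \<Longrightarrow> \<bar>r - r0\<bar> < d \<Longrightarrow> \<bar>g r - g r0\<bar> < e"
    using assms(2,3) unfolding continuous_on_iff dist_real_def by (metis atLeast_iff)
  show thesis
    by (rule that[of "d/2"]) (use d in \<open>force intro: less_imp_le\<close>)+
qed

lemma class_K_small:
  assumes "class_K g" "0 < e"
  obtains d where "0 < d" "g d \<le> e"
proof -
  obtain d where "0 < d" "\<And>r. 0 \<le> r \<Longrightarrow> \<bar>r - 0\<bar> \<le> d \<Longrightarrow> \<bar>g r - g 0\<bar> \<le> e"
    using class_K_cont[OF assms(1) order_refl assms(2)] by metis
  then show thesis using that[of d] class_K_zero[OF assms(1)] by (metis abs_le_D1 abs_of_pos diff_zero less_imp_le order_refl)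
qed

lemma class_KinfD: "class_Kinf g \<Longrightarrow> class_K g"
  unfolding class_Kinf_def by auto

lemma class_KinfI:
  assumes "continuous_on {0..} g" "\<And>r s. 0 \<le> r \<Longrightarrow> r < s \<Longrightarrow> g r < g s" "g 0 = 0"
    "\<And>M. \<exists>r\<ge>0. M < g r"
  shows "class_Kinf g"
  using assms unfolding class_Kinf_def class_K_def strict_mono_on_def by auto

lemma class_Kinf_add:
  assumes f: "class_Kinf f" and g: "class_Kinf g"
  shows "class_Kinf (\<lambda>r. f r + g r)"
proof (rule class_KinfI)
  note K = class_KinfD[OF f] class_KinfD[OF g]
  show "continuous_on {0..} (\<lambda>r. f r + g r)"
    using K unfolding class_K_def by (auto intro: continuous_intros)
  show "f r + g r < f s + g s" if "0 \<le> r" "r < s" for r s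
    using that class_K_less K by (metis add_strict_mono)
  show "f 0 + g 0 = 0" using K[THEN class_K_zero] by simp
  show "\<exists>r\<ge>0. M < f r + g r" for M
    using f class_K_nonneg[OF K(2)] unfolding class_Kinf_def by (meson add_increasing2 less_le_trans order_refl)
qed

lemma class_Kinf_id: "class_Kinf (\<lambda>r. r)"
  proof (rule class_KinfI)
  show "\<exists>r\<ge>0. M < r" for M :: real by (rule exI[of _ "max 0 M + 1"]) auto
qed auto

lemma class_Kinf_scale:
  assumes f: "class_Kinf f" and c: "0 < c"
  shows "class_Kinf (\<lambda>r. f r * c)"
proof (rule class_KinfI)
  note K = class_KinfD[OF f]
  show "continuous_on {0..} (\<lambda>r. f r * c)"
    using K unfolding class_K_def by (auto intro: continuous_intros)
  show "f r * c < f s * c" if "0 \<le> r" "r < s" for r s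
    using that class_K_less[OF K] c by simp
  show "f 0 * c = 0" using K[THEN class_K_zero] by simp
  show "\<exists>r\<ge>0. M < f r * c" for M
    using f c unfolding class_Kinf_def by (metis pos_divide_less_eq)
qed

lemma class_Kinf_min:
  assumes f: "class_Kinf f" and g: "class_Kinf g"
  shows "class_Kinf (\<lambda>r. min (f r) (g r))"
proof (rule class_KinfI)
  note K = class_KinfD[OF f] class_KinfD[OF g]
  show "continuous_on {0..} (\<lambda>r. min (f r) (g r))"
    using K unfolding class_K_def by (auto intro: continuous_intros)
  show "min (f r) (g r) < min (f s) (g s)" if "0 \<le> r" "r < s" for r s
    using class_K_less[OF K(1) that] class_K_less[OF K(2) that] by auto
  show "min (f 0) (g 0) = 0" using K[THEN class_K_zero] by simp
  show "\<exists>r\<ge>0. M < min (f r) (g r)" for M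
  proof -
    obtain r s where r: "0 \<le> r" "M < f r" and s: "0 \<le> s" "M < g s"
      using f g unfolding class_Kinf_def by meson
    have "f r \<le> f (max r s)" "g s \<le> g (max r s)"
      using class_K_mono[OF K(1)] class_K_mono[OF K(2)] r s by auto
    then show ?thesis using r s by (intro exI[of _ "max r s"]) auto
  qed
qed

lemma class_Kinf_compose:
  assumes f: "class_Kinf f" and g: "class_Kinf g"
  shows "class_Kinf (\<lambda>r. f (g r))"
proof (rule class_KinfI)
  note K = class_KinfD[OF f] class_KinfD[OF g]
  show "continuous_on {0..} (\<lambda>r. f (g r))"
  proof -
    have "continuous_on {0..} f" "continuous_on {0..} g" using K unfolding class_K_def by auto
    moreover have "g ` {0..} \<subseteq> {0..}" using class_K_nonneg[OF K(2)] by auto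
    ultimately show ?thesis using continuous_on_compose2[of "{0..}" f "{0..}" g] by metis
  qed
  show "f (g r) < f (g s)" if "0 \<le> r" "r < s" for r s
    using class_K_less[OF K(1) class_K_nonneg[OF K(2) that(1)] class_K_less[OF K(2) that]] .
  show "f (g 0) = 0" using K[THEN class_K_zero] by simp
  show "\<exists>r\<ge>0. M < f (g r)" for M
  proof -
    obtain s where s: "0 \<le> s" "M < f s" using f unfolding class_Kinf_def by meson
    obtain r where r: "0 \<le> r" "s < g r" using g unfolding class_Kinf_def by meson
    have "f s \<le> f (g r)" using class_K_mono[OF K(1)] r s by auto
    then show ?thesis using r s by (intro exI[of _ r]) auto
  qed
qed

lemma class_Kinf_inv:
  assumes f: "class_Kinf f" and y: "0 \<le> y"
  shows "0 \<le> inv_into {0..} f y" "f (inv_into {0..} f y) = y"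
proof -
  note K = class_KinfD[OF f]
  obtain b where b: "0 \<le> b" "y < f b" using f unfolding class_Kinf_def by blast
  have "continuous_on {0..b} f" using K unfolding class_K_def by (auto elim: continuous_on_subset)
  then obtain x where "0 \<le> x" "f x = y"
    using IVT'[of f 0 y b] b y class_K_zero[OF K] by auto
  then have "y \<in> f ` {0..}" by auto
  then show "0 \<le> inv_into {0..} f y" "f (inv_into {0..} f y) = y"
    using inv_into_into[of y f "{0..}"] f_inv_into_f[of y f "{0..}"] by auto
qed

section \<open>Majorants of class K_oo and KL for families of monotone functions\<close>

lemma SUP_diff_le:
  fixes f g :: "'a \<Rightarrow> real"
  assumes "A \<noteq> {}" "bdd_above (f ` A)" "bdd_above (g ` A)" "\<And>x. x \<in> A \<Longrightarrow> \<bar>f x - g x\<bar> \<le> d"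
  shows "\<bar>(SUP x\<in>A. f x) - (SUP x\<in>A. g x)\<bar> \<le> d"
proof -
  have *: "(SUP x\<in>A. f x) \<le> (SUP x\<in>A. g x) + d"
    if "bdd_above (g ` A)" "\<And>x. x \<in> A \<Longrightarrow> \<bar>f x - g x\<bar> \<le> d" for f g :: "'a \<Rightarrow> real"
  proof (rule cSUP_least[OF assms(1)])
    fix x assume x: "x \<in> A"
    then show "f x \<le> (SUP x\<in>A. g x) + d"
      using cSUP_upper[OF x that(1)] that(2)[OF x] by linarith
  qed
  show ?thesis
    using *[of g f] *[of f g] assms by (simp add: abs_le_iff abs_minus_commute)
qed

text \<open>The pointwise supremum \<open>C\<close> is nondecreasing and small near 0, but it may
  jump. Smearing it with ramps gives \<open>\<psi>\<close> with
  \<open>C r \<le> \<psi> r \<le> C (2 * r)\<close>: the lower bound makes it a majorant, the upper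
  one gives continuity at 0. The summand \<open>r\<close> added at the end supplies strict growth
  and unboundedness.\<close>

lemma Kinf_majorant:
  fixes f :: "'k \<Rightarrow> real \<Rightarrow> real"
  assumes mono: "\<And>k r s. 0 \<le> r \<Longrightarrow> r \<le> s \<Longrightarrow> f k r \<le> f k s"
    and zero: "\<And>k. f k 0 = 0"
    and bdd: "\<And>R. 0 \<le> R \<Longrightarrow> \<exists>B. \<forall>k. f k R \<le> B"
    and small: "\<And>e. 0 < e \<Longrightarrow> \<exists>d>0. \<forall>k. f k d \<le> e"
  shows "\<exists>\<kappa>. class_Kinf \<kappa> \<and> (\<forall>k. \<forall>r\<ge>0. f k r \<le> \<kappa> r)"
proof -
  define C where "C q = (SUP k. f k q)" for q
  have bdd': "bdd_above (range (\<lambda>k. f k q))" if "0 \<le> q" for q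
    using bdd[OF that] by (auto intro: bdd_aboveI)
  have fC: "f k q \<le> C q" if "0 \<le> q" for k q
    unfolding C_def by (rule cSUP_upper[OF UNIV_I bdd'[OF that]])
  have C_le: "C q \<le> B" if "\<And>k. f k q \<le> B" for q B
    unfolding C_def using that by (intro cSUP_least) auto
  have C0: "0 \<le> C q" if "0 \<le> q" for q
    using fC[OF that] mono[OF order_refl that] by (metis zero order_trans)
  have Cmono: "C q \<le> C q'" if "0 \<le> q" "q \<le> q'" for q q'
    using mono[OF that] fC[of q'] that by (intro C_le) (meson order_trans)
  \<comment> \<open>The ramps \<open>\<theta> q\<close> are Lipschitz on \<open>[a, \<infinity>)\<close> uniformly in \<open>q\<close>, which makes the supremum continuous.\<close>
  define \<theta> where "\<theta> q r = min 1 (max 0 (2 * r / q - 1))" for q r :: real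
  define \<psi> where "\<psi> r = (SUP q\<in>{0<..}. C q * \<theta> q r)" for r
  have \<theta>01: "0 \<le> \<theta> q r" "\<theta> q r \<le> 1" for q r unfolding \<theta>_def by auto
  have term_le: "C q * \<theta> q r \<le> C (2 * r)" if "0 < q" "0 \<le> r" for q r
  proof (cases "q \<le> 2 * r")
    case True
    then have "C q * \<theta> q r \<le> C q * 1" using C0[of q] \<theta>01 that by (intro mult_left_mono) auto
    also have "\<dots> \<le> C (2 * r)" using Cmono[of q "2 * r"] True that by auto
    finally show ?thesis .
  next
    case False
    then have "\<theta> q r = 0" using that unfolding \<theta>_def by (simp add: field_simps)
    then show ?thesis using C0[of "2 * r"] that by auto
  qed
  have \<psi>bdd: "bdd_above ((\<lambda>q. C q * \<theta> q r) ` {0<..})" if "0 \<le> r" for r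
    using term_le[OF _ that] by (auto intro!: bdd_aboveI[of _ "C (2 * r)"])
  have \<psi>ub: "C q * \<theta> q r \<le> \<psi> r" if "0 < q" "0 \<le> r" for q r
    unfolding \<psi>_def using that by (intro cSUP_upper[OF _ \<psi>bdd]) auto
  have \<psi>le: "\<psi> r \<le> C (2 * r)" if "0 \<le> r" for r
    unfolding \<psi>_def using that term_le by (intro cSUP_least) auto
  have \<psi>0: "0 \<le> \<psi> r" if "0 \<le> r" for r
    using \<psi>ub[of 1 r] C0[of 1] \<theta>01[of 1 r] that by (meson mult_nonneg_nonneg order_trans zero_le_one zero_less_one)
  have C\<psi>: "C r \<le> \<psi> r" if "0 \<le> r" for r
  proof (cases "r = 0")
    case True
    then have "C r \<le> 0" using zero by (intro C_le) auto
    then show ?thesis using \<psi>0[of r] that by auto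
  next
    case False
    then have "\<theta> r r = 1" unfolding \<theta>_def by auto
    then show ?thesis using \<psi>ub[of r r] False that by auto
  qed
  have \<theta>mono: "\<theta> q r \<le> \<theta> q s" if "0 < q" "r \<le> s" for q r s
    using that divide_right_mono[of "2 * r" "2 * s" q] unfolding \<theta>_def by auto
  have \<psi>mono: "\<psi> r \<le> \<psi> s" if "0 \<le> r" "r \<le> s" for r s
  proof -
    have "C q * \<theta> q r \<le> \<psi> s" if q: "0 < q" for q
    proof -
      have "C q * \<theta> q r \<le> C q * \<theta> q s"
        using C0[of q] \<theta>mono[OF q \<open>r \<le> s\<close>] q by (intro mult_left_mono) auto
      also have "\<dots> \<le> \<psi> s" using \<psi>ub[OF q] \<open>0 \<le> r\<close> \<open>r \<le> s\<close> by auto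
      finally show ?thesis .
    qed
    then show ?thesis unfolding \<psi>_def[of r] by (intro cSUP_least) auto
  qed
  have lip: "\<bar>C q * \<theta> q r - C q * \<theta> q s\<bar> \<le> C (2 * b) * (2 / a) * \<bar>r - s\<bar>"
    if "0 < a" "a \<le> r" "r \<le> b" "a \<le> s" "s \<le> b" "0 < q" for a b q r s
  \<comment> \<open>On the interval from \<open>a\<close> to \<open>b\<close> the ramp is constantly
    1 for \<open>q \<le> a\<close> and constantly 0 for \<open>q > 2 * b\<close>. Only the remaining
    \<open>q\<close> contribute a slope, and this is at most \<open>2 / a\<close>.\<close>
  proof (cases "q \<le> a \<or> 2 * b < q")
    case True
    have nn: "0 \<le> C (2 * b) * (2 / a) * \<bar>r - s\<bar>" using C0[of "2 * b"] that by auto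
    show ?thesis
    proof (cases "q \<le> a")
      case True
      then have "1 \<le> 2 * r / q - 1" "1 \<le> 2 * s / q - 1" using that by (auto simp: field_simps)
      then show ?thesis using nn unfolding \<theta>_def by simp
    next
      case F: False
      then have "2 * r / q \<le> 1" "2 * s / q \<le> 1" using that True by (auto simp: field_simps)
      then show ?thesis using nn unfolding \<theta>_def by simp
    qed
  next
    case False
    then have q: "a < q" "q \<le> 2 * b" by auto
    have "\<bar>\<theta> q r - \<theta> q s\<bar> \<le> \<bar>2 * r / q - 2 * s / q\<bar>" unfolding \<theta>_def by (simp add: max_def min_def)
    also have "2 * r / q - 2 * s / q = (2 / q) * (r - s)" by (simp add: diff_divide_distrib right_diff_distrib)
    also have "\<bar>\<dots>\<bar> = (2 / q) * \<bar>r - s\<bar>" using that by (simp only: abs_mult) simp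
    also have "\<dots> \<le> (2 / a) * \<bar>r - s\<bar>" using q that by (intro mult_right_mono) (auto simp: frac_le)
    finally have 1: "\<bar>\<theta> q r - \<theta> q s\<bar> \<le> (2 / a) * \<bar>r - s\<bar>" .
    have "\<bar>C q * \<theta> q r - C q * \<theta> q s\<bar> = C q * \<bar>\<theta> q r - \<theta> q s\<bar>"
      using C0[of q] that by (simp add: abs_mult right_diff_distrib[symmetric])
    also have "\<dots> \<le> C (2 * b) * ((2 / a) * \<bar>r - s\<bar>)"
      using 1 Cmono[of q "2 * b"] C0[of "2 * b"] q that by (intro mult_mono) auto
    finally show ?thesis by (simp add: mult.assoc)
  qed
  have \<psi>lip: "\<bar>\<psi> r - \<psi> s\<bar> \<le> C (2 * b) * (2 / a) * \<bar>r - s\<bar>"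
    if "0 < a" "a \<le> r" "r \<le> b" "a \<le> s" "s \<le> b" for a b r s
    unfolding \<psi>_def using that by (intro SUP_diff_le \<psi>bdd lip) auto
  have "continuous_on {0..} \<psi>"
    unfolding continuous_on_iff
  proof (intro ballI allI impI)
    fix r e :: real assume r: "r \<in> {0..}" and e: "0 < e"
    show "\<exists>d>0. \<forall>x'\<in>{0..}. dist x' r < d \<longrightarrow> dist (\<psi> x') (\<psi> r) < e"
    proof (cases "r = 0")
      case True
      obtain d where d: "0 < d" "\<forall>k. f k d \<le> e / 2" using small[of "e/2"] e by auto
      have "\<psi> x < e" if "0 \<le> x" "x < d / 2" for x
      proof -
        have "\<psi> x \<le> C (2 * x)" using \<psi>le that by auto
        also have "\<dots> \<le> C d" using that by (intro Cmono) auto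
        also have "\<dots> \<le> e / 2" using d by (intro C_le) auto
        finally show ?thesis using e by simp
      qed
      moreover have "\<psi> 0 = 0" using \<psi>0[of 0] \<psi>le[of 0] C_le[of 0 0] zero by (auto intro: antisym)
      ultimately show ?thesis using True d(1) \<psi>0 by (intro exI[of _ "d/2"]) (auto simp: dist_real_def)
    next
      case False
      define L where "L = C (2 * (2 * r)) * (2 / (r / 2)) + 1"
      have L: "0 < L" using C0[of "2 * (2 * r)"] r False unfolding L_def by (auto intro!: add_nonneg_pos)
      show ?thesis
      proof (intro exI[of _ "min (r / 2) (e / L)"] conjI ballI impI)
        show "0 < min (r / 2) (e / L)" using r False L e by auto
        fix x assume x: "x \<in> {0..}" "dist x r < min (r / 2) (e / L)"
        then have "\<bar>x - r\<bar> < r / 2" "\<bar>x - r\<bar> < e / L" by (auto simp: dist_real_def)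
        then have "\<bar>\<psi> x - \<psi> r\<bar> \<le> C (2 * (2 * r)) * (2 / (r / 2)) * \<bar>x - r\<bar>"
          using r False by (intro \<psi>lip[of "r/2" x "2 * r" r]) (auto simp: abs_if split: if_splits)
        also have "\<dots> \<le> L * \<bar>x - r\<bar>" unfolding L_def by (simp add: algebra_simps)
        also have "\<dots> < e" using \<open>\<bar>x - r\<bar> < e / L\<close> L by (simp add: field_simps)
        finally show "dist (\<psi> x) (\<psi> r) < e" by (simp add: dist_real_def)
      qed
    qed
  qed
  moreover have "\<psi> 0 = 0" using \<psi>0[of 0] \<psi>le[of 0] C_le[of 0 0] zero by (auto intro: antisym)
  ultimately have "class_Kinf (\<lambda>r. r + \<psi> r)"
  proof (intro class_KinfI)
    show "\<exists>r\<ge>0. M < r + \<psi> r" for M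
      using \<psi>0[of "max 0 M + 1"] by (intro exI[of _ "max 0 M + 1"]) auto
  qed (auto intro!: continuous_intros add_less_le_mono \<psi>mono)
  moreover have "f k r \<le> r + \<psi> r" if "0 \<le> r" for k r
    using fC[OF that, of k] C\<psi>[OF that] that by auto
  ultimately show ?thesis by (intro exI[of _ "\<lambda>r. r + \<psi> r"]) auto
qed

text \<open>Uniform attraction leaves only finitely many \<open>n\<close> to treat separately, which
  gives one bound \<open>\<kappa>\<close> for all \<open>n\<close>. For the decay, level and radius
  are tied to a single parameter: a pair \<open>(v, n)\<close> in \<open>S\<close> records that at
  time \<open>n\<close> the radius \<open>1 / v\<close> has not yet been attracted to the level
  \<open>v\<close>. Attraction then becomes convergence to 0 of one function \<open>u\<close> of
  time.\<close>

lemma KL_majorant: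
  fixes f :: "nat \<Rightarrow> 'k \<Rightarrow> real \<Rightarrow> real"
  assumes mono: "\<And>n k r s. 0 \<le> r \<Longrightarrow> r \<le> s \<Longrightarrow> f n k r \<le> f n k s"
    and zero: "\<And>n k. f n k 0 = 0"
    and bdd: "\<And>n R. 0 \<le> R \<Longrightarrow> \<exists>B. \<forall>k. f n k R \<le> B"
    and small: "\<And>n e. 0 < e \<Longrightarrow> \<exists>d>0. \<forall>k. f n k d \<le> e"
    and attr: "\<And>R e. 0 < R \<Longrightarrow> 0 < e \<Longrightarrow> \<exists>N. \<forall>n\<ge>N. \<forall>k. f n k R \<le> e"
  shows "\<exists>\<beta>. class_KL \<beta> \<and> (\<forall>n k. \<forall>r\<ge>0. f n k r \<le> \<beta> r (real n))"
proof -
  have "\<exists>\<kappa>. class_Kinf \<kappa> \<and> (\<forall>p. \<forall>r\<ge>0. (case p of (n, k) \<Rightarrow> f n k) r \<le> \<kappa> r)"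
  proof (rule Kinf_majorant)
    fix R :: real assume R: "0 \<le> R"
    obtain N where N: "\<And>n k. n \<ge> N \<Longrightarrow> f n k (max 1 R) \<le> 1" using attr[of "max 1 R" 1] by (auto simp: less_max_iff_disj)
    obtain B where B: "\<And>n k. f n k (max 1 R) \<le> B n" using bdd[of "max 1 R"] R by (metis max.coboundedI2)
    have "f n k R \<le> Max (insert 1 (B ` {..<N}))" for n k
    proof (cases "n < N")
      case True
      have "f n k R \<le> B n" using order_trans[OF mono[OF R max.cobounded2] B] .
      also have "\<dots> \<le> Max (insert 1 (B ` {..<N}))" using True by (intro Max_ge) auto
      finally show ?thesis .
    next
      case False
      have "f n k R \<le> 1" using order_trans[OF mono[OF R max.cobounded2] N] False by simp
      also have "\<dots> \<le> Max (insert 1 (B ` {..<N}))" by (intro Max_ge) auto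
      finally show ?thesis .
    qed
    then show "\<exists>B. \<forall>p. (case p of (n, k) \<Rightarrow> f n k) R \<le> B" by auto
  next
    fix e :: real assume e: "0 < e"
    obtain N where N: "\<And>n k. n \<ge> N \<Longrightarrow> f n k 1 \<le> e" using attr[of 1 e] e by auto
    obtain d where d: "\<And>n. 0 < d n" "\<And>n k. f n k (d n) \<le> e" using small[OF e] by metis
    define D where "D = Min (insert 1 (d ` {..<N}))"
    have D: "0 < D" "D \<le> 1" "\<And>n. n < N \<Longrightarrow> D \<le> d n" unfolding D_def using d(1) by auto
    have "f n k D \<le> e" for n k
      using mono[of D "d n" n k] mono[of D 1 n k] D d(2)[of n k] N[of n k] by (cases "n < N") force+
    then show "\<exists>d>0. \<forall>p. (case p of (n, k) \<Rightarrow> f n k) d \<le> e" using D(1) by auto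
  qed (auto intro: mono simp: zero)
  then obtain \<kappa> where \<kappa>: "class_Kinf \<kappa>" and f\<kappa>: "\<And>n k r. 0 \<le> r \<Longrightarrow> f n k r \<le> \<kappa> r" by auto
  note \<kappa>K = class_KinfD[OF \<kappa>]
  define S where "S = insert (0, 0) {(v, n). 0 < v \<and> (\<exists>k. v < f n k (1 / v))}"
  \<comment> \<open>A level \<open>v\<close> recorded at time \<open>n\<close> counts fully up to
    time \<open>n\<close> and decays exponentially afterwards. This makes the supremum over
    \<open>S\<close> nonincreasing and Lipschitz in time.\<close>
  define h where "h p t = fst p * min 1 (exp (real (snd p) - t))" for p :: "real \<times> nat" and t
  \<comment> \<open>For \<open>v > 1\<close> the radius \<open>1 / v\<close> is below 1, so a
    recorded level satisfies \<open>v < \<kappa> (1 / v) \<le> \<kappa> 1\<close>.\<close>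
  define V where "V = max 1 (\<kappa> 1)"
  have V: "0 \<le> v \<and> v \<le> V" if "(v, n) \<in> S" for v n
  proof (rule ccontr)
    assume a: "\<not> (0 \<le> v \<and> v \<le> V)"
    with that have v: "0 < v" "V < v" "\<exists>k. v < f n k (1 / v)" unfolding S_def V_def by auto
    then obtain k where "v < f n k (1 / v)" by auto
    also have "\<dots> \<le> \<kappa> (1 / v)" using f\<kappa> v by auto
    also have "\<dots> \<le> \<kappa> 1" using v unfolding V_def by (intro class_K_mono[OF \<kappa>K]) auto
    finally show False using v unfolding V_def by auto
  qed
  have h_le: "h p t \<le> V" "0 \<le> h p t" if "p \<in> S" for p t
  proof -
    obtain v n where p: "p = (v, n)" by fastforce
    have "h p t \<le> v * 1" unfolding h_def p fst_conv using V[of v n] that p by (intro mult_left_mono) auto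
    moreover have "0 \<le> h p t" unfolding h_def p using V[of v n] that p by auto
    ultimately show "h p t \<le> V" "0 \<le> h p t" using V[of v n] that p by auto
  qed
  have h_bdd: "bdd_above ((\<lambda>p. h p t) ` S)" for t using h_le by (auto intro!: bdd_aboveI)
  \<comment> \<open>\<open>S\<close> is chosen so that \<open>f n k (1 / u n) \<le> u n\<close>. Hence \<open>f n k r\<close> is bounded by \<open>min (\<kappa> r) (u n)\<close>
    for \<open>r \<le> 1 / u n\<close>, and by \<open>\<kappa> r * r * u n\<close> for larger \<open>r\<close>.\<close>
  define u where "u t = exp (- t) + (SUP p\<in>S. h p t)" for t
  have S0: "(0, 0) \<in> S" unfolding S_def by auto
  then have Sne: "S \<noteq> {}" by auto
  have sup_ge: "h p t \<le> (SUP p\<in>S. h p t)" if "p \<in> S" for p t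
    by (rule cSUP_upper[OF that h_bdd])
  have upos: "0 < u t" for t
    using sup_ge[OF S0, of t] h_le(2)[OF S0, of t] unfolding u_def by (auto intro!: add_pos_nonneg)
  have u_anti: "u t2 < u t1" if "t1 < t2" for t1 t2
  proof -
    have "(SUP p\<in>S. h p t2) \<le> (SUP p\<in>S. h p t1)"
    proof (rule cSUP_least[OF Sne])
      fix p assume p: "p \<in> S"
      have "0 \<le> fst p" using V[of "fst p" "snd p"] p by auto
      then have "h p t2 \<le> h p t1" using that unfolding h_def by (intro mult_left_mono min.mono) auto
      then show "h p t2 \<le> (SUP p\<in>S. h p t1)" using sup_ge[OF p, of t1] by linarith
    qed
    then show ?thesis using that unfolding u_def by (auto intro: add_less_le_mono)
  qed
  have expo: "\<bar>min 1 (exp (x :: real)) - min 1 (exp y)\<bar> \<le> \<bar>x - y\<bar>" for x y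
  proof -
    have *: "min 1 (exp x) - min 1 (exp y) \<le> x - y \<and> 0 \<le> min 1 (exp x) - min 1 (exp y)" if "y \<le> x" for x y :: real
    proof (cases "y \<le> 0")
      case True
      define z where "z = min x 0"
      have z: "min 1 (exp x) = exp z" "y \<le> z" "z \<le> x" "z \<le> 0" "min 1 (exp y) = exp y"
        unfolding z_def using that True by (auto simp: min_def)
      have "1 - exp (y - z) \<le> z - y" using exp_ge_add_one_self[of "y - z"] by linarith
      then have "exp z * (1 - exp (y - z)) \<le> exp z * (z - y)" by (rule mult_left_mono) simp
      also have "\<dots> \<le> 1 * (z - y)" using z by (intro mult_right_mono) auto
      finally have "exp z - exp y \<le> z - y" by (simp add: algebra_simps exp_diff)
      then show ?thesis using z by auto
    next
      case False
      then show ?thesis using that by auto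
    qed
    show ?thesis using *[of x y] *[of y x] by linarith
  qed
  have "\<bar>(SUP p\<in>S. h p t) - (SUP p\<in>S. h p t')\<bar> \<le> V * \<bar>t - t'\<bar>" for t t'
  proof (rule SUP_diff_le[OF Sne h_bdd h_bdd])
    fix p assume p: "p \<in> S"
    have vp: "0 \<le> fst p" "fst p \<le> V" using V[of "fst p" "snd p"] p by auto
    have "\<bar>h p t - h p t'\<bar> = fst p * \<bar>min 1 (exp (real (snd p) - t)) - min 1 (exp (real (snd p) - t'))\<bar>"
      unfolding h_def using vp by (simp add: abs_mult right_diff_distrib[symmetric])
    also have "\<dots> \<le> V * \<bar>(real (snd p) - t) - (real (snd p) - t')\<bar>"
      by (rule mult_mono[OF vp(2) expo]) (use vp in auto)
    finally show "\<bar>h p t - h p t'\<bar> \<le> V * \<bar>t - t'\<bar>" by (simp add: abs_minus_commute)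
  qed
  then have "V-lipschitz_on UNIV (\<lambda>t. SUP p\<in>S. h p t)"
    unfolding V_def by (intro lipschitz_onI) (auto simp: dist_real_def)
  then have ucont: "continuous_on A u" for A
    unfolding u_def using lipschitz_on_continuous_on continuous_on_subset
    by (intro continuous_intros) blast
  have exp0: "((\<lambda>t. exp (- t :: real)) \<longlongrightarrow> 0) at_top"
    by (rule filterlim_compose[OF exp_at_bot filterlim_uminus_at_bot_at_top])
  have ulim: "(u \<longlongrightarrow> 0) at_top"
  proof (rule tendstoI)
    fix e :: real assume e: "0 < e"
    define e' where "e' = e / 3"
    have e': "0 < e'" using e e'_def by auto
    obtain N where N: "\<And>n k. n \<ge> N \<Longrightarrow> f n k (1 / e') \<le> e'" using attr[of "1/e'" e'] e' by auto
    \<comment> \<open>Levels up to \<open>e'\<close> are harmless. A level above \<open>e'\<close>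
      concerns a radius below \<open>1 / e'\<close> and so can be recorded only before time
      \<open>N\<close>, after which it decays at least as fast as
      \<open>V * exp (N - t)\<close>.\<close>
    have sup_le: "(SUP p\<in>S. h p t) \<le> e'" if t: "V * exp (real N - t) \<le> e'" for t
    proof (rule cSUP_least[OF Sne])
      fix p assume p: "p \<in> S"
      obtain v n where pv: "p = (v, n)" by fastforce
      have v: "0 \<le> v" "v \<le> V" using V[of v n] p pv by auto
      have h1: "h p t \<le> v * 1" "h p t \<le> v * exp (real n - t)"
        unfolding h_def pv fst_conv snd_conv using v by (intro mult_left_mono; simp)+
      show "h p t \<le> e'"
      proof (cases "v \<le> e'")
        case True then show ?thesis using h1 by auto
      next
        case False
        then obtain k where k: "v < f n k (1 / v)" using p e' unfolding S_def pv by auto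
        have "n < N"
        proof (rule ccontr)
          assume "\<not> n < N"
          then have "f n k (1 / e') \<le> e'" using N by auto
          moreover have "f n k (1 / v) \<le> f n k (1 / e')" using False e' by (intro mono) (auto simp: frac_le)
          ultimately show False using k False by auto
        qed
        then have "v * exp (real n - t) \<le> V * exp (real N - t)" using v by (intro mult_mono) auto
        then show ?thesis using h1 t by auto
      qed
    qed
    have "(\<lambda>t. V * exp (real N - t)) = (\<lambda>t. V * exp (real N) * exp (- t))"
      by (simp add: exp_diff exp_minus field_simps)
    then have "((\<lambda>t. V * exp (real N - t)) \<longlongrightarrow> 0) at_top" using tendsto_mult_right_zero[OF exp0] by simp
    then have "\<forall>\<^sub>F t in at_top. V * exp (real N - t) < e'" using e' by (rule order_tendstoD)
    moreover have "\<forall>\<^sub>F t in at_top. exp (- t :: real) < e'" using exp0 e' by (rule order_tendstoD)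
    ultimately have "\<forall>\<^sub>F t in at_top. u t < e"
    proof eventually_elim
      case (elim t)
      then show ?case using sup_le[of t] e unfolding u_def e'_def by linarith
    qed
    then show "\<forall>\<^sub>F t in at_top. dist (u t) 0 < e"
      by eventually_elim (use upos in \<open>simp add: less_imp_le\<close>)
  qed
  have key: "f n k (1 / u n) \<le> u n" for n k
  proof (rule ccontr)
    assume "\<not> f n k (1 / u n) \<le> u n"
    then have "(u n, n) \<in> S" unfolding S_def using upos[of n] by (force simp: not_le)
    from sup_ge[OF this, of "real n"] show False unfolding u_def[of "real n"] h_def by auto
  qed
  \<comment> \<open>The product term also provides the strict monotonicity in \<open>r\<close> and
    in \<open>t\<close>, which \<open>min\<close> alone lacks where it follows only one of its
    arguments.\<close>
  define \<beta> where "\<beta> r t = min (\<kappa> r) (u t) + \<kappa> r * r * u t" for r t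
  have \<kappa>c: "continuous_on {0..} \<kappa>" using \<kappa>K class_K_def by auto
  have \<kappa>0: "0 \<le> \<kappa> r" if "0 \<le> r" for r using class_K_nonneg[OF \<kappa>K that] .
  have "class_KL \<beta>"
    unfolding class_KL_def
  proof (intro conjI allI impI)
    have c: "continuous_on ({0..} \<times> {0..}) (\<lambda>x. \<kappa> (fst x))" "continuous_on ({0..} \<times> {0..}) (\<lambda>x. u (snd x))"
      by (rule continuous_on_compose2[OF \<kappa>c] continuous_on_compose2[OF ucont[of UNIV]]; auto intro: continuous_intros)+
    show "continuous_on ({0..} \<times> {0..}) (\<lambda>(r, t). \<beta> r t)"
      unfolding \<beta>_def case_prod_beta by (intro continuous_intros c)
    show "class_K (\<lambda>r. \<beta> r t)" if "0 \<le> t" for t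
      unfolding class_K_def strict_mono_on_def
    proof (intro conjI allI impI)
      show "continuous_on {0..} (\<lambda>r. \<beta> r t)" unfolding \<beta>_def by (intro continuous_intros \<kappa>c)
      fix r s :: real assume "r \<in> {0..} \<and> s \<in> {0..} \<and> r < s"
      then have rs: "0 \<le> r" "r < s" by auto
      have "\<kappa> r < \<kappa> s" by (rule class_K_less[OF \<kappa>K rs])
      then have "\<kappa> r * r < \<kappa> s * s" using rs \<kappa>0 by (intro mult_strict_mono') auto
      then have "\<kappa> r * r * u t < \<kappa> s * s * u t" using upos by simp
      moreover have "min (\<kappa> r) (u t) \<le> min (\<kappa> s) (u t)" using \<open>\<kappa> r < \<kappa> s\<close> by auto
      ultimately show "\<beta> r t < \<beta> s t" unfolding \<beta>_def by linarith
    next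
      show "\<beta> 0 t = 0" unfolding \<beta>_def using class_K_zero[OF \<kappa>K] upos[of t] by auto
    qed
    fix r :: real assume r: "0 < r"
    then have \<kappa>r: "0 < \<kappa> r" using class_K_pos[OF \<kappa>K] by auto
    show "continuous_on {0..} (\<beta> r)" unfolding \<beta>_def by (intro continuous_intros ucont)
    show "\<beta> r t2 < \<beta> r t1" if "0 \<le> t1" "t1 < t2" for t1 t2
    proof -
      have "u t2 < u t1" using u_anti that by auto
      then have "\<kappa> r * r * u t2 < \<kappa> r * r * u t1" using r \<kappa>r by simp
      moreover have "min (\<kappa> r) (u t2) \<le> min (\<kappa> r) (u t1)" using \<open>u t2 < u t1\<close> by auto
      ultimately show ?thesis unfolding \<beta>_def by linarith
    qed
    have "(\<beta> r \<longlongrightarrow> min (\<kappa> r) 0 + \<kappa> r * r * 0) at_top"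
      unfolding \<beta>_def by (intro tendsto_intros ulim)
    then show "(\<beta> r \<longlongrightarrow> 0) at_top" using \<kappa>r by simp
  qed
  moreover have "f n k r \<le> \<beta> r (real n)" if r: "0 \<le> r" for n k r
  proof (cases "r \<le> 1 / u n")
    case True
    then have "f n k r \<le> u n" using mono[OF r True, of n k] key[of n k] by linarith
    then have "f n k r \<le> min (\<kappa> r) (u n)" using f\<kappa>[OF r, of n k] by auto
    moreover have "0 \<le> \<kappa> r * r * u n" using \<kappa>0 r upos[of n] by auto
    ultimately show ?thesis unfolding \<beta>_def by linarith
  next
    case False
    then have "1 \<le> r * u n" using upos[of n] by (simp add: field_simps)
    then have "\<kappa> r * 1 \<le> \<kappa> r * (r * u n)" using \<kappa>0 r by (intro mult_left_mono) auto
    moreover have "0 \<le> min (\<kappa> r) (u n)" using \<kappa>0 r upos[of n] by auto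
    ultimately show ?thesis unfolding \<beta>_def mult.assoc using f\<kappa>[OF r, of n k] by linarith
  qed
  ultimately show ?thesis by blast
qed

section \<open>Uniformly bi-Lipschitz families\<close>

text \<open>The rate integrated below may blow up at 0, so the antiderivative is taken on the open
  half line and not as an integral from 0.\<close>

lemma antiderivative_pos:
  fixes f :: "real \<Rightarrow> real"
  assumes "continuous_on {0<..} f"
  shows "\<exists>F. \<forall>x>0. (F has_real_derivative f x) (at x)"
proof -
  have "isCont f x" if "0 < x" for x
    using assms that by (simp add: continuous_on_eq_continuous_at open_greaterThan)
  then have "\<exists>F. \<forall>x::real. (0::ereal) < ereal x \<longrightarrow> ereal x < \<infinity> \<longrightarrow> (F has_vector_derivative f x) (at x)"
    by (intro einterval_antiderivative) auto
  then obtain F where "\<And>x. 0 < x \<Longrightarrow> (F has_vector_derivative f x) (at x)" by force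
  then show ?thesis unfolding has_real_derivative_iff_has_vector_derivative by blast
qed

text \<open>\<open>S i r\<close> is the infimum of \<open>R i s + F r - F s\<close> over
  \<open>0 < s \<le> r\<close>, that is, \<open>R i\<close> with its growth throttled to the rate
  \<open>L = F'\<close>, which is common to all \<open>i\<close>. It stays within \<open>g\<close>
  of \<open>R i\<close> as soon as \<open>R i r - R i s \<le> g r + (F r - F s)\<close>, and
  \<open>L\<close> is designed to make this true.\<close>

lemma equicontinuous_Lipschitz_minorant:
  fixes R :: "'k \<Rightarrow> real \<Rightarrow> real"
  assumes mono: "\<And>i s r. 0 < s \<Longrightarrow> s \<le> r \<Longrightarrow> R i s \<le> R i r"
    and bound: "\<And>i r. 0 < r \<Longrightarrow> 0 \<le> R i r \<and> R i r \<le> \<phi> r"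
    and equi: "\<And>r e. 0 < r \<Longrightarrow> 0 < e \<Longrightarrow> \<exists>d>0. \<forall>s>0. \<bar>s - r\<bar> < d \<longrightarrow> (\<forall>i. \<bar>R i s - R i r\<bar> \<le> e)"
    and \<phi>: "class_K \<phi>" and g: "class_K g"
  shows "\<exists>S. (\<forall>i. \<forall>r>0. R i r - g r \<le> S i r \<and> S i r \<le> R i r) \<and>
    (\<forall>i s r. 0 < s \<longrightarrow> s \<le> r \<longrightarrow> S i s \<le> S i r) \<and>
    (\<forall>a>0. \<forall>b. \<exists>L. \<forall>i s r. a \<le> s \<longrightarrow> s \<le> r \<longrightarrow> r \<le> b \<longrightarrow> S i r - S i s \<le> L * (r - s))"
proof -
  define W where "W x = {w. 0 \<le> w \<and> w \<le> x / 2 \<and>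
    (\<forall>i s t. 0 < s \<longrightarrow> x - w \<le> s \<longrightarrow> s \<le> t \<longrightarrow> t \<le> x + w \<longrightarrow> R i t - R i s \<le> g s)}" for x :: real
  \<comment> \<open>A Lebesgue number at \<open>x\<close>: no \<open>R i\<close> grows by more than \<open>g\<close> within distance \<open>w x\<close> of \<open>x\<close>.
    It is 1-Lipschitz because balls are nested.\<close>
  define w where "w x = Sup (W x)" for x
  have W0: "0 \<in> W x" if "0 < x" for x
  proof -
    have "R i t - R i s \<le> g s" if "0 < s" "x \<le> s" "s \<le> t" "t \<le> x" for i s t
    proof -
      have "t = s" using that by simp
      then have "R i t = R i s" by (rule arg_cong)
      then show ?thesis using class_K_nonneg[OF g, of s] that by linarith
    qed
    then show ?thesis using that unfolding W_def by simp
  qed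
  have Wbdd: "bdd_above (W x)" for x
    unfolding W_def by (auto intro!: bdd_aboveI[of _ "x / 2"])
  have W_le: "v \<le> w x" if "v \<in> W x" for v x
    unfolding w_def using that Wbdd by (rule cSup_upper)
  have w_le: "w x \<le> B" if "0 < x" "\<And>v. v \<in> W x \<Longrightarrow> v \<le> B" for x B
    unfolding w_def using W0[OF that(1)] that(2) by (intro cSup_least) auto
  have w_half: "w x \<le> x / 2" if "0 < x" for x
    by (rule w_le[OF that]) (auto simp: W_def)
  have wlip: "w x \<le> w y + \<bar>x - y\<bar>" if xy: "0 < x" "0 < y" for x y
  proof (rule w_le[OF xy(1)])
    fix v assume v: "v \<in> W x"
    show "v \<le> w y + \<bar>x - y\<bar>"
    proof (cases "v \<le> \<bar>x - y\<bar>")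
      case True
      then show ?thesis using W_le[OF W0[OF xy(2)]] by auto
    next
      case False
      have "R i t - R i s \<le> g s"
        if "0 < s" "y - (v - \<bar>x - y\<bar>) \<le> s" "s \<le> t" "t \<le> y + (v - \<bar>x - y\<bar>)" for i s t
      proof -
        have "x - v \<le> s" "t \<le> x + v" using that by linarith+
        then show ?thesis using v that unfolding W_def by blast
      qed
      moreover have "v - \<bar>x - y\<bar> \<le> y / 2" using v xy unfolding W_def by (auto simp: abs_if field_simps)
      ultimately have "v - \<bar>x - y\<bar> \<in> W y" using False unfolding W_def by auto
      then show ?thesis using W_le by force
    qed
  qed
  have wpos: "0 < w x" if x: "0 < x" for x
  proof -
    define e where "e = g (x / 2) / 2"
    have e: "0 < e" using class_K_pos[OF g] x unfolding e_def by auto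
    obtain d where d: "0 < d" "\<And>s i. 0 < s \<Longrightarrow> \<bar>s - x\<bar> < d \<Longrightarrow> \<bar>R i s - R i x\<bar> \<le> e"
      using equi[OF x e] by blast
    define v where "v = min (x / 2) (d / 2)"
    have v: "0 < v" "v \<le> x / 2" "v < d" using x d(1) unfolding v_def by auto
    have "R i t - R i s \<le> g s" if "0 < s" "x - v \<le> s" "s \<le> t" "t \<le> x + v" for i s t
    proof -
      have "\<bar>R i s - R i x\<bar> \<le> e" "\<bar>R i t - R i x\<bar> \<le> e" using that v by (auto intro!: d(2))
      moreover have "g (x / 2) \<le> g s" using that v x by (intro class_K_mono[OF g]) auto
      ultimately show ?thesis unfolding e_def by linarith
    qed
    then have "v \<in> W x" using v unfolding W_def by auto
    then show ?thesis using W_le v(1) by force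
  qed
  have wcont: "continuous_on {0<..} w"
  proof (rule lipschitz_on_continuous_on[of 1], rule lipschitz_onI)
    fix x y :: real assume "x \<in> {0<..}" "y \<in> {0<..}"
    then show "dist (w x) (w y) \<le> 1 * dist x y"
      using wlip[of x y] wlip[of y x] by (auto simp: dist_real_def)
  qed auto
  \<comment> \<open>For z between \<open>r - w r / 2\<close> and \<open>r\<close>, the 1-Lipschitz
    \<open>w\<close> has \<open>w z \<le> 3/2 * w r\<close>, and \<open>r \<le> 2 * z\<close>. With
    the factor 3 an antiderivative of \<open>L\<close> therefore gains at least
    \<open>\<phi> r\<close> over this window of length \<open>w r / 2\<close>.\<close>
  define L where "L t = 3 * \<phi> (2 * t) / w t" for t
  have \<phi>0: "0 \<le> \<phi> r" if "0 \<le> r" for r by (rule class_K_nonneg[OF \<phi> that])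
  have L0: "0 \<le> L t" if "0 < t" for t
    unfolding L_def using \<phi>0[of "2 * t"] wpos[OF that] that by auto
  have "continuous_on {0<..} (\<lambda>t. \<phi> (2 * t))"
    by (rule continuous_on_compose2[of "{0..}" \<phi>]) (use \<phi> in \<open>auto simp: class_K_def intro!: continuous_intros\<close>)
  then have Lcont: "continuous_on {0<..} L"
    unfolding L_def using wcont wpos by (auto intro!: continuous_intros) (metis less_irrefl)
  obtain F where F: "\<And>x. 0 < x \<Longrightarrow> (F has_real_derivative L x) (at x)"
    using antiderivative_pos[OF Lcont] by blast
  have Fmvt: "\<exists>z. s < z \<and> z < r \<and> F r - F s = (r - s) * L z" if "0 < s" "s < r" for s r
    using MVT2[of s r F L] F that by force
  have Fmono: "F s \<le> F r" if sr: "0 < s" "s \<le> r" for s r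
  proof (cases "s = r")
    case False
    then obtain z where "s < z" "F r - F s = (r - s) * L z" using Fmvt[of s r] sr by (auto simp: less_le)
    moreover from this have "0 \<le> (r - s) * L z" using L0[of z] sr by (intro mult_nonneg_nonneg) auto
    ultimately show ?thesis by linarith
  qed auto
  \<comment> \<open>If \<open>s\<close> lies within the window of \<open>r\<close>, the choice of
    \<open>w\<close> bounds the growth of \<open>R i\<close> by \<open>g\<close>. Otherwise
    \<open>F\<close> alone has gained \<open>\<phi> r\<close>, which exceeds any possible growth of
    \<open>R i\<close>.\<close>
  have key: "R i r - R i s \<le> g r + (F r - F s)" if s: "0 < s" "s \<le> r" for i s r
  proof (cases "r - s \<le> w r / 2")
    case True
    have r: "0 < r" using s by auto
    have "w r / 2 < Sup (W r)" using wpos[OF r] unfolding w_def by auto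
    then obtain v where v: "v \<in> W r" "w r / 2 < v" using less_cSupD[of "W r"] W0[OF r] by blast
    then have "r - v \<le> s" "r \<le> r + v" using True wpos[OF r] by linarith+
    then have "R i r - R i s \<le> g s" using v(1) s unfolding W_def by blast
    also have "\<dots> \<le> g r" using class_K_mono[OF g] s by auto
    finally show ?thesis using Fmono[OF s] by auto
  next
    case False
    have r: "0 < r" using s by auto
    define q where "q = r - w r / 2"
    have q: "s < q" "q < r" "r / 2 \<le> q" using False w_half[OF r] wpos[OF r] unfolding q_def by auto
    then obtain z where z: "q < z" "z < r" "F r - F q = (r - q) * L z" using Fmvt[of q r] s by auto
    have z0: "0 < z" using z q s by auto
    have "w z \<le> w r + \<bar>z - r\<bar>" using wlip[OF z0 r] .
    then have wz: "w z \<le> 3 / 2 * w r" using z unfolding q_def by auto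
    have "R i r \<le> \<phi> r" using bound[OF r] by auto
    also have "\<dots> \<le> \<phi> (2 * z)" using z q r by (intro class_K_mono[OF \<phi>]) auto
    also have "\<dots> = (\<phi> (2 * z) / w z) * w z" using wpos[OF z0] by simp
    also have "\<dots> \<le> (\<phi> (2 * z) / w z) * (3 / 2 * w r)"
      using wz \<phi>0[of "2 * z"] wpos[OF z0] z0 by (intro mult_left_mono) auto
    also have "\<dots> = F r - F q" unfolding z(3) by (simp add: L_def q_def mult_ac)
    also have "\<dots> \<le> F r - F s" using Fmono[of s q] s q by auto
    finally show ?thesis using bound[OF s(1), of i] class_K_nonneg[OF g, of r] r by linarith
  qed
  define S where "S i r = (INF s\<in>{0<..r}. R i s + F r - F s)" for i r
  have bddS: "bdd_below ((\<lambda>s. R i s + F r - F s) ` {0<..r})" for i r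
    by (rule bdd_belowI[of _ "R i r - g r"]) (use key[of _ r i] in force)
  have S_le: "S i r \<le> R i s + F r - F s" if "0 < s" "s \<le> r" for i s r
    unfolding S_def using that by (intro cINF_lower bddS) auto
  have le_S: "B \<le> S i r" if "0 < r" "\<And>s. 0 < s \<Longrightarrow> s \<le> r \<Longrightarrow> B \<le> R i s + F r - F s" for i r B
    unfolding S_def using that by (intro cINF_greatest) auto
  show ?thesis
  proof (intro exI[of _ S] conjI allI impI)
    fix i and r :: real assume r: "0 < r"
    show "R i r - g r \<le> S i r" using key[of _ r i] by (intro le_S[OF r]) force
    show "S i r \<le> R i r" using S_le[OF r, of r i] by auto
  next
    fix i and s r :: real assume s: "0 < s" "s \<le> r"
    show "S i s \<le> S i r"
    proof (rule le_S)
      fix t assume t: "0 < t" "t \<le> r"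
      show "S i s \<le> R i t + F r - F t"
      proof (cases "t \<le> s")
        case True
        then show ?thesis using S_le[of t s i] Fmono[of s r] t s by linarith
      next
        case False
        then have "R i s \<le> R i t" "F t \<le> F r" using mono[of s t i] Fmono[of t r] t s by auto
        then show ?thesis using S_le[of s s i] s by linarith
      qed
    qed (use s in auto)
  next
    fix a b :: real assume a: "0 < a"
    show "\<exists>L. \<forall>i s r. a \<le> s \<longrightarrow> s \<le> r \<longrightarrow> r \<le> b \<longrightarrow> S i r - S i s \<le> L * (r - s)"
    proof (cases "a \<le> b")
      case True
      have "continuous_on {a..b} L" using Lcont a by (auto elim!: continuous_on_subset)
      then obtain M where "\<forall>t\<in>{a..b}. L t \<le> L M"
        using continuous_attains_sup[of "{a..b}" L] True by auto
      then have M: "L t \<le> L M" if "a \<le> t" "t \<le> b" for t using that by simp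
      have "S i r - S i s \<le> L M * (r - s)" if sr: "a \<le> s" "s \<le> r" "r \<le> b" for i s r
      proof (cases "s = r")
        case False
        then obtain z where z: "s < z" "z < r" "F r - F s = (r - s) * L z" using Fmvt[of s r] sr a by (auto simp: less_le)
        then have "F r - F s \<le> (r - s) * L M" using M[of z] sr by (auto intro!: mult_left_mono)
        \<comment> \<open>Every competitor in the infimum for \<open>S i s\<close> is also one for
          \<open>S i r\<close>, at a cost higher by \<open>F r - F s\<close>.\<close>
        moreover have "S i r - (F r - F s) \<le> S i s"
        proof (rule le_S)
          fix t assume "0 < t" "t \<le> s"
          then show "S i r - (F r - F s) \<le> R i t + F s - F t" using S_le[of t r i] sr by linarith
        qed (use sr a in auto)
        ultimately show ?thesis by (simp add: mult.commute)
      qed auto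
      then show ?thesis by blast
    qed force
  qed
qed

text \<open>With \<open>h = g / 2\<close>, the minorant of \<open>P + h\<close> with tolerance
  \<open>h\<close> is nondecreasing, locally Lipschitz and between \<open>P\<close> and
  \<open>P + h\<close>. Adding a function \<open>G\<close> with \<open>0 \<le> G \<le> h\<close> and
  slope bounded away from 0 on compact sets uses the other half of the gap and gives the lower slope
  bound.\<close>

lemma bi_Lipschitz_sandwich:
  fixes P :: "'k \<Rightarrow> real \<Rightarrow> real"
  assumes mono: "\<And>i s r. 0 < s \<Longrightarrow> s \<le> r \<Longrightarrow> P i s \<le> P i r"
    and bound: "\<And>i r. 0 < r \<Longrightarrow> 0 \<le> P i r \<and> P i r \<le> \<phi> r"
    and equi: "\<And>r e. 0 < r \<Longrightarrow> 0 < e \<Longrightarrow> \<exists>d>0. \<forall>s>0. \<bar>s - r\<bar> < d \<longrightarrow> (\<forall>i. \<bar>P i s - P i r\<bar> \<le> e)"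
    and \<phi>: "class_Kinf \<phi>" and g: "class_Kinf g"
  shows "\<exists>S. (\<forall>i. \<forall>r>0. P i r \<le> S i r \<and> S i r \<le> P i r + g r) \<and>
    (\<forall>a>0. \<forall>b. \<exists>l>0. \<exists>L\<ge>l. \<forall>i s r. a \<le> s \<longrightarrow> s \<le> r \<longrightarrow> r \<le> b \<longrightarrow>
      l * (r - s) \<le> S i r - S i s \<and> S i r - S i s \<le> L * (r - s))"
proof -
  note gK = class_KinfD[OF g]
  define h where "h r = g r * (1/2)" for r
  have h: "class_Kinf h" unfolding h_def by (rule class_Kinf_scale[OF g]) auto
  note hK = class_KinfD[OF h]
  have "\<exists>S. (\<forall>i. \<forall>r>0. P i r + h r - h r \<le> S i r \<and> S i r \<le> P i r + h r) \<and>
    (\<forall>i s r. 0 < s \<longrightarrow> s \<le> r \<longrightarrow> S i s \<le> S i r) \<and>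
    (\<forall>a>0. \<forall>b. \<exists>L. \<forall>i s r. a \<le> s \<longrightarrow> s \<le> r \<longrightarrow> r \<le> b \<longrightarrow> S i r - S i s \<le> L * (r - s))"
  proof (rule equicontinuous_Lipschitz_minorant[where R = "\<lambda>i r. P i r + h r" and \<phi> = "\<lambda>r. \<phi> r + h r"])
    show "P i s + h s \<le> P i r + h r" if "0 < s" "s \<le> r" for i s r
      using mono[OF that, of i] class_K_mono[OF hK, of s r] that by auto
    show "0 \<le> P i r + h r \<and> P i r + h r \<le> \<phi> r + h r" if "0 < r" for i r
      using bound[OF that, of i] class_K_nonneg[OF hK, of r] that by auto
    fix r e :: real assume r: "0 < r" and e: "0 < e"
    obtain d1 where d1: "0 < d1" "\<And>s i. 0 < s \<Longrightarrow> \<bar>s - r\<bar> < d1 \<Longrightarrow> \<bar>P i s - P i r\<bar> \<le> e / 2"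
      using equi[of r "e/2"] r e by auto
    obtain d2 where d2: "0 < d2" "\<And>s. 0 \<le> s \<Longrightarrow> \<bar>s - r\<bar> \<le> d2 \<Longrightarrow> \<bar>h s - h r\<bar> \<le> e / 2"
      using class_K_cont[OF hK, of r "e/2"] r e by auto
    show "\<exists>d>0. \<forall>s>0. \<bar>s - r\<bar> < d \<longrightarrow> (\<forall>i. \<bar>P i s + h s - (P i r + h r)\<bar> \<le> e)"
    proof (intro exI[of _ "min d1 d2"] conjI allI impI)
      fix s i assume "0 < s" "\<bar>s - r\<bar> < min d1 d2"
      then show "\<bar>P i s + h s - (P i r + h r)\<bar> \<le> e" using d1(2)[of s i] d2(2)[of s] by linarith
    qed (use d1 d2 in auto)
  qed (use class_KinfD[OF class_Kinf_add[OF \<phi> h]] hK in auto)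
  then obtain S where S': "\<forall>i. \<forall>r>0. P i r + h r - h r \<le> S i r \<and> S i r \<le> P i r + h r"
    and Smono: "\<forall>i s r. 0 < s \<longrightarrow> s \<le> r \<longrightarrow> S i s \<le> S i r"
    and SL: "\<forall>a>0. \<forall>b. \<exists>L. \<forall>i s r. a \<le> s \<longrightarrow> s \<le> r \<longrightarrow> r \<le> b \<longrightarrow> S i r - S i s \<le> L * (r - s)"
    by (elim exE conjE) (rule that)
  have S: "P i r \<le> S i r \<and> S i r \<le> P i r + h r" if "0 < r" for i r
    using S' that by simp
  \<comment> \<open>The slope of \<open>G\<close>. It is positive for \<open>t > 0\<close>, and
    since \<open>h\<close> is increasing and exp(-t) has total mass 1, the integral of
    \<open>f\<close> from 0 to \<open>r\<close> is at most \<open>h r\<close>. The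
    \<open>max\<close> extends \<open>h\<close> continuously to the whole line, so that an
    antiderivative exists across 0.\<close>
  define f where "f t = h (max 0 t) * exp (- t)" for t
  have "continuous_on {0..} h" using hK class_K_def by auto
  then have "continuous_on UNIV (\<lambda>t. h (max 0 t))"
    by (rule continuous_on_compose2) (auto intro!: continuous_intros)
  then have "continuous_on UNIV f" unfolding f_def by (intro continuous_intros)
  then have "\<exists>H. \<forall>x::real. -\<infinity> < ereal x \<longrightarrow> ereal x < \<infinity> \<longrightarrow> (H has_vector_derivative f x) (at x)"
    by (intro einterval_antiderivative) (auto simp: continuous_on_eq_continuous_at)
  then obtain H where H: "\<And>x. (H has_real_derivative f x) (at x)"
    unfolding has_real_derivative_iff_has_vector_derivative by force
  define G where "G r = H r - H 0" for r
  have Gmvt: "\<exists>z. s < z \<and> z < r \<and> G r - G s = (r - s) * f z" if "s < r" for s r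
    using MVT2[of s r H f] H that unfolding G_def by force
  have Gh: "G r \<le> h r" if r: "0 < r" for r
  proof -
    \<comment> \<open>The derivative \<open>h r * exp (- t) - f t\<close> is nonnegative on the
      interval from 0 to \<open>r\<close>; comparing end points gives
      \<open>G r \<le> h r * (1 - exp (- r))\<close>.\<close>
    define D where "D t = h r * (1 - exp (- t)) - H t" for t
    have "D 0 \<le> D r"
    proof (rule DERIV_nonneg_imp_nondecreasing[of 0 r])
      fix t assume t: "0 \<le> t" "t \<le> r"
      have "(D has_real_derivative h r * exp (- t) - f t) (at t)"
        unfolding D_def by (auto intro!: derivative_eq_intros H)
      moreover have "0 \<le> h r * exp (- t) - f t"
        unfolding f_def using class_K_mono[OF hK, of t r] t by (auto intro!: mult_right_mono)
      ultimately show "\<exists>y. (D has_real_derivative y) (at t) \<and> 0 \<le> y" by blast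
    qed (use r in auto)
    then have "G r \<le> h r * (1 - exp (- r))" unfolding D_def G_def by simp
    also have "\<dots> \<le> h r * 1" using class_K_nonneg[OF hK, of r] r by (intro mult_left_mono) auto
    finally show ?thesis by simp
  qed
  have G0: "0 \<le> G r" if r: "0 < r" for r
  proof -
    obtain z where "0 < z" "G r - G 0 = r * f z" using Gmvt[OF r] by auto
    then show ?thesis using r class_K_nonneg[OF hK, of z] unfolding f_def G_def by auto
  qed
  show ?thesis
  proof (intro exI[of _ "\<lambda>i r. S i r + G r"] conjI allI impI)
    fix i and r :: real assume r: "0 < r"
    show "P i r \<le> S i r + G r" "S i r + G r \<le> P i r + g r"
      using S[OF r, of i] G0[OF r] Gh[OF r] unfolding h_def by auto
  next
    fix a b :: real assume a: "0 < a"
    obtain L where L: "\<And>i s r. a \<le> s \<Longrightarrow> s \<le> r \<Longrightarrow> r \<le> b \<Longrightarrow> S i r - S i s \<le> L * (r - s)"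
      using SL a by blast
    define l where "l = h a * exp (- b)"
    define L' where "L' = L + h b"
    have lpos: "0 < l" unfolding l_def using class_K_pos[OF hK a] by auto
    \<comment> \<open>The \<open>max\<close> secures the required order of the two constants when
      \<open>a < b\<close> fails, since then \<open>L\<close> may be any number.\<close>
    have main: "l * (r - s) \<le> S i r + G r - (S i s + G s) \<and> S i r + G r - (S i s + G s) \<le> max l L' * (r - s)"
      if sr: "a \<le> s" "s \<le> r" "r \<le> b" for i s r
    proof (cases "s = r")
      case False
      then obtain z where z: "s < z" "z < r" "G r - G s = (r - s) * f z" using Gmvt[of s r] sr by (auto simp: less_le)
      have hz: "h a \<le> h z" "h z \<le> h b" "0 \<le> h z" using z sr a by (auto intro!: class_K_mono[OF hK] class_K_nonneg[OF hK])
      have "l \<le> f z" unfolding l_def f_def using z sr a hz class_K_pos[OF hK a] by (intro mult_mono) auto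
      moreover have "f z \<le> h b * 1" unfolding f_def using z sr a hz by (intro mult_mono) auto
      ultimately have "l * (r - s) \<le> G r - G s" "G r - G s \<le> h b * (r - s)"
        unfolding z(3) mult.commute[of "r - s"] using sr by (auto intro: mult_right_mono)
      moreover have "S i s \<le> S i r" using Smono sr a by auto
      moreover have "S i r - S i s \<le> L * (r - s)" using L sr by auto
      moreover have "L' * (r - s) \<le> max l L' * (r - s)" using sr by (intro mult_right_mono) auto
      ultimately show ?thesis unfolding L'_def by (simp add: algebra_simps)
    qed auto
    show "\<exists>l>0. \<exists>L\<ge>l. \<forall>i s r. a \<le> s \<longrightarrow> s \<le> r \<longrightarrow> r \<le> b \<longrightarrow>
      l * (r - s) \<le> S i r + G r - (S i s + G s) \<and> S i r + G r - (S i s + G s) \<le> L * (r - s)"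
      using lpos main by (intro exI[of _ l] conjI exI[of _ "max l L'"]) auto
  qed
qed

text \<open>\<open>S\<close> is controlled only on the positive axis; the value 0 at 0 is continuous
  because \<open>\<phi>2\<close> squeezes it. Slopes between \<open>l\<close> and \<open>L\<close>
  become slopes between \<open>1 / L\<close> and \<open>1 / l\<close> of the inverses, provided the
  preimages of \<open>K\<close> stay in a compact set independent of \<open>i\<close>.\<close>

lemma bi_Lipschitz_Kinf_family:
  fixes S :: "'k \<Rightarrow> real \<Rightarrow> real"
  assumes bound: "\<And>i r. 0 < r \<Longrightarrow> \<phi>1 r \<le> S i r \<and> S i r \<le> \<phi>2 r"
    and \<phi>: "class_Kinf \<phi>1" "class_Kinf \<phi>2"
    and lip: "\<And>a b. 0 < a \<Longrightarrow> \<exists>l>0. \<exists>L\<ge>l. \<forall>i s r. a \<le> s \<longrightarrow> s \<le> r \<longrightarrow> r \<le> b \<longrightarrow>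
      l * (r - s) \<le> S i r - S i s \<and> S i r - S i s \<le> L * (r - s)"
  defines "\<sigma> \<equiv> \<lambda>r i. if r \<le> 0 then 0 else S i r"
  shows "class_Kinf (\<lambda>r. \<sigma> r i)"
    and "compact K \<Longrightarrow> K \<subseteq> {0<..} \<Longrightarrow>
      \<exists>l L. 0 < l \<and> l \<le> L \<and> (\<forall>r1\<in>K. \<forall>r2\<in>K. \<forall>i.
        l * \<bar>r1 - r2\<bar> \<le> \<bar>inv_into {0..} (\<lambda>r. \<sigma> r i) r1 - inv_into {0..} (\<lambda>r. \<sigma> r i) r2\<bar> \<and>
        \<bar>inv_into {0..} (\<lambda>r. \<sigma> r i) r1 - inv_into {0..} (\<lambda>r. \<sigma> r i) r2\<bar> \<le> L * \<bar>r1 - r2\<bar>)"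
proof -
  note K1 = class_KinfD[OF \<phi>(1)] and K2 = class_KinfD[OF \<phi>(2)]
  have abs_lip: "\<exists>l>0. \<exists>L\<ge>l. \<forall>i. \<forall>s\<in>{a..b}. \<forall>r\<in>{a..b}.
      l * \<bar>r - s\<bar> \<le> \<bar>\<sigma> r i - \<sigma> s i\<bar> \<and> \<bar>\<sigma> r i - \<sigma> s i\<bar> \<le> L * \<bar>r - s\<bar>" if a: "0 < a" for a b
  proof -
    obtain l L where l: "0 < l" "l \<le> L" and lL: "\<And>i s r. a \<le> s \<Longrightarrow> s \<le> r \<Longrightarrow> r \<le> b \<Longrightarrow>
        l * (r - s) \<le> S i r - S i s \<and> S i r - S i s \<le> L * (r - s)"
      using lip[OF a, of b] by blast
    have "l * \<bar>r - s\<bar> \<le> \<bar>\<sigma> r i - \<sigma> s i\<bar> \<and> \<bar>\<sigma> r i - \<sigma> s i\<bar> \<le> L * \<bar>r - s\<bar>"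
      if "s \<in> {a..b}" "r \<in> {a..b}" for i s r
    proof -
      have *: "l * \<bar>r - s\<bar> \<le> \<bar>S i r - S i s\<bar> \<and> \<bar>S i r - S i s\<bar> \<le> L * \<bar>r - s\<bar>"
        if "a \<le> s" "s \<le> r" "r \<le> b" for s r
      proof -
        have "0 \<le> l * (r - s)" using l that by auto
        then show ?thesis using lL[OF that, of i] that by auto
      qed
      have "s \<le> r \<or> r \<le> s" by linarith
      then show ?thesis
        using *[of s r] *[of r s] that a unfolding \<sigma>_def by (auto simp: abs_minus_commute)
    qed
    then show ?thesis using l by blast
  qed
  have \<sigma>_bound: "\<phi>1 r \<le> \<sigma> r i \<and> \<sigma> r i \<le> \<phi>2 r" if "0 \<le> r" for r i
    using that bound[of r i] class_K_zero[OF K1] class_K_zero[OF K2] unfolding \<sigma>_def by auto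
  have \<sigma>_less: "\<sigma> r i < \<sigma> s i" if rs: "0 \<le> r" "r < s" for r s i
  proof (cases "r = 0")
    case True
    then show ?thesis using rs bound[of s i] class_K_pos[OF K1, of s] unfolding \<sigma>_def by auto
  next
    case False
    then have "0 < r" using rs by simp
    from lip[OF this, of s] obtain l where "0 < l" "l * (s - r) \<le> S i s - S i r"
      using rs by (meson less_imp_le order_refl)
    moreover have "0 < l * (s - r)" using \<open>0 < l\<close> \<open>r < s\<close> by simp
    ultimately have "S i r < S i s" by linarith
    then show ?thesis using rs False unfolding \<sigma>_def by auto
  qed
  have Kinf: "class_Kinf (\<lambda>r. \<sigma> r i)" for i
  proof (rule class_KinfI)
    show "\<sigma> 0 i = 0" unfolding \<sigma>_def by simp
    show "\<exists>r\<ge>0. M < \<sigma> r i" for M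
      using \<phi>(1) \<sigma>_bound unfolding class_Kinf_def by (meson less_le_trans)
    show "continuous_on {0..} (\<lambda>r. \<sigma> r i)"
      unfolding continuous_on_iff
    proof (intro ballI allI impI)
      fix r e :: real assume r: "r \<in> {0..}" and e: "0 < e"
      show "\<exists>d>0. \<forall>x'\<in>{0..}. dist x' r < d \<longrightarrow> dist (\<sigma> x' i) (\<sigma> r i) < e"
      proof (cases "r = 0")
        case True
        obtain d where d: "0 < d" "\<phi>2 d \<le> e / 2" using class_K_small[OF K2, of "e/2"] e by auto
        have "\<bar>\<sigma> x i\<bar> < e" if x: "0 \<le> x" "x < d" for x
        proof -
          have "\<sigma> x i \<le> \<phi>2 x" "0 \<le> \<sigma> x i"
            using \<sigma>_bound[OF x(1), of i] class_K_nonneg[OF K1 x(1)] by auto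
          moreover have "\<phi>2 x \<le> \<phi>2 d" using x by (intro class_K_mono[OF K2]) auto
          ultimately show ?thesis using d e by auto
        qed
        moreover have "\<sigma> r i = 0" using True unfolding \<sigma>_def by simp
        ultimately show ?thesis using True d(1) by (intro exI[of _ d]) (auto simp: dist_real_def)
      next
        case False
        then have r0: "0 < r" using r by auto
        have "0 < r / 2" using r0 by simp
        from abs_lip[OF this, of "2 * r"] obtain l L where "0 < l" "l \<le> L"
          and L2: "\<forall>i. \<forall>s\<in>{r/2..2*r}. \<forall>r'\<in>{r/2..2*r}.
            l * \<bar>r' - s\<bar> \<le> \<bar>\<sigma> r' i - \<sigma> s i\<bar> \<and> \<bar>\<sigma> r' i - \<sigma> s i\<bar> \<le> L * \<bar>r' - s\<bar>"
          by (elim exE conjE) (rule that)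
        then have L: "0 < L" by simp
        show ?thesis
        proof (intro exI[of _ "min (r/2) (e/L)"] conjI ballI impI)
          fix x assume x: "x \<in> {0..}" "dist x r < min (r/2) (e/L)"
          then have x': "\<bar>x - r\<bar> < r / 2" "\<bar>x - r\<bar> < e / L" by (auto simp: dist_real_def)
          then have "x \<in> {r/2..2*r}" "r \<in> {r/2..2*r}" using r0 by (auto simp: abs_if split: if_splits)
          then have "\<bar>\<sigma> x i - \<sigma> r i\<bar> \<le> L * \<bar>x - r\<bar>" using L2 by blast
          also have "\<dots> < e" using x' L by (simp add: field_simps)
          finally show "dist (\<sigma> x i) (\<sigma> r i) < e" by (simp add: dist_real_def)
        qed (use r0 e L in auto)
      qed
    qed
  qed (rule \<sigma>_less)
  then show "class_Kinf (\<lambda>r. \<sigma> r i)" .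
  assume K: "compact K" "K \<subseteq> {0<..}"
  show "\<exists>l L. 0 < l \<and> l \<le> L \<and> (\<forall>r1\<in>K. \<forall>r2\<in>K. \<forall>i.
        l * \<bar>r1 - r2\<bar> \<le> \<bar>inv_into {0..} (\<lambda>r. \<sigma> r i) r1 - inv_into {0..} (\<lambda>r. \<sigma> r i) r2\<bar> \<and>
        \<bar>inv_into {0..} (\<lambda>r. \<sigma> r i) r1 - inv_into {0..} (\<lambda>r. \<sigma> r i) r2\<bar> \<le> L * \<bar>r1 - r2\<bar>)"
  proof (cases "K = {}")
    case True
    then show ?thesis by (intro exI[of _ 1]) auto
  next
    case False
    obtain m where m: "m \<in> K" "\<And>y. y \<in> K \<Longrightarrow> m \<le> y" using compact_attains_inf[OF K(1) False] by auto
    obtain M where M: "M \<in> K" "\<And>y. y \<in> K \<Longrightarrow> y \<le> M" using compact_attains_sup[OF K(1) False] by auto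
    have m0: "0 < m" using m K by auto
    \<comment> \<open>\<open>\<phi>1\<close> and \<open>\<phi>2\<close> bound all components at
      once: every component is below \<open>min K\<close> at \<open>a\<close> and above
      \<open>max K\<close> at \<open>b\<close>, so all preimages of \<open>K\<close> lie between
      \<open>a\<close> and \<open>b\<close>.\<close>
    obtain b where b: "0 \<le> b" "M < \<phi>1 b" using \<phi>(1) unfolding class_Kinf_def by blast
    obtain a where a: "0 < a" "\<phi>2 a \<le> m / 2" using class_K_small[OF K2, of "m/2"] m0 by auto
    obtain l L where l: "0 < l" "l \<le> L" and lL: "\<And>i s r. s \<in> {a..b} \<Longrightarrow> r \<in> {a..b} \<Longrightarrow>
      l * \<bar>r - s\<bar> \<le> \<bar>\<sigma> r i - \<sigma> s i\<bar> \<and> \<bar>\<sigma> r i - \<sigma> s i\<bar> \<le> L * \<bar>r - s\<bar>"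
      using abs_lip[OF a(1), of b] by blast
    let ?inv = "\<lambda>i. inv_into {0..} (\<lambda>r. \<sigma> r i)"
    have inv: "\<sigma> (?inv i y) i = y" "?inv i y \<in> {a..b}" if y: "y \<in> K" for i y
    proof -
      have y0: "0 \<le> y" using y K by force
      note I = class_Kinf_inv[OF Kinf y0, of i]
      show "\<sigma> (?inv i y) i = y" by (rule I(2))
      have "\<not> ?inv i y < a"
      proof
        assume "?inv i y < a"
        from \<sigma>_less[OF I(1) this, of i] have "y < \<sigma> a i" using I(2) by simp
        then show False using \<sigma>_bound[of a i] a m(2)[OF y] m0 by auto
      qed
      moreover have "\<not> b < ?inv i y"
      proof
        assume "b < ?inv i y"
        from \<sigma>_less[OF b(1) this, of i] have "\<sigma> b i < y" using I(2) by simp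
        then show False using \<sigma>_bound[OF b(1), of i] b M(2)[OF y] by auto
      qed
      ultimately show "?inv i y \<in> {a..b}" by auto
    qed
    show ?thesis
    proof (rule exI[of _ "1 / L"], rule exI[of _ "1 / l"], intro conjI ballI allI)
      show "0 < 1 / L" "1 / L \<le> 1 / l" using l by (auto simp: frac_le)
      fix y1 y2 i assume y: "y1 \<in> K" "y2 \<in> K"
      have *: "l * \<bar>?inv i y1 - ?inv i y2\<bar> \<le> \<bar>y1 - y2\<bar>" "\<bar>y1 - y2\<bar> \<le> L * \<bar>?inv i y1 - ?inv i y2\<bar>"
        using lL[OF inv(2)[OF y(2)] inv(2)[OF y(1)], of i i i] inv(1) y by auto
      show "1 / L * \<bar>y1 - y2\<bar> \<le> \<bar>?inv i y1 - ?inv i y2\<bar>"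
        using * l by (simp add: field_simps)
      show "\<bar>?inv i y1 - ?inv i y2\<bar> \<le> 1 / l * \<bar>y1 - y2\<bar>"
        using * l by (simp add: field_simps)
    qed
  qed
qed

section \<open>Max-type gain operators\<close>

lemma lposD: "lpos s \<Longrightarrow> 0 \<le> s i"
  unfolding lpos_def by auto

lemma lpos_le_lnorm: "lpos s \<Longrightarrow> s i \<le> lnorm s"
  unfolding lpos_def lnorm_def
  by (metis (mono_tags, lifting) abs_of_nonneg cSUP_upper iso_tuple_UNIV_I)

lemma lnorm_nonneg: "lpos s \<Longrightarrow> 0 \<le> lnorm s"
  using lpos_le_lnorm lposD order_trans by metis

lemma lposI: "(\<And>i. 0 \<le> s i) \<Longrightarrow> (\<And>i. s i \<le> B) \<Longrightarrow> lpos s"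
  unfolding lpos_def by (auto intro!: bdd_aboveI[of _ B])

lemma lnorm_le: "(\<And>i. 0 \<le> s i) \<Longrightarrow> (\<And>i. s i \<le> B) \<Longrightarrow> lnorm s \<le> B"
  unfolding lnorm_def by (rule cSUP_least) auto

lemma lnorm_const: "0 \<le> R \<Longrightarrow> lnorm (\<lambda>_. R) = R"
  by (simp add: lnorm_def)

lemma Gam_ge: "finite (II i) \<Longrightarrow> j \<in> II i \<Longrightarrow> gam i j (s j) \<le> Gam II gam s i"
  unfolding Gam_def by auto

lemma Gam_cases:
  assumes "finite (II i)"
  obtains "II i = {}" "Gam II gam s i = 0" | j where "j \<in> II i" "Gam II gam s i = gam i j (s j)"
proof (cases "II i = {}")
  case False
  then have "Gam II gam s i \<in> (\<lambda>j. gam i j (s j)) ` II i"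
    using Max_in[of "(\<lambda>j. gam i j (s j)) ` II i"] assms unfolding Gam_def by simp
  then show ?thesis using that by auto
qed (auto simp: Gam_def that)

text \<open>The gains that turn \<open>Gam_rho\<close> into a plain max-type operator, see
  \<open>Gam_rho_eq\<close>. An empty neighbourhood is consistent with this because
  \<open>\<rho> 0 = 0\<close>.\<close>

definition boost :: "(real \<Rightarrow> real) \<Rightarrow> ('i \<Rightarrow> 'i \<Rightarrow> real \<Rightarrow> real) \<Rightarrow> 'i \<Rightarrow> 'i \<Rightarrow> real \<Rightarrow> real" where
  "boost \<rho> gam = (\<lambda>i j r. gam i j r + \<rho> (gam i j r))"

lemma in_nbhd_self: "i \<in> in_nbhd II i n"
  by (induction n) auto

lemma in_nbhd_step: "k \<in> II i \<Longrightarrow> in_nbhd II k n \<subseteq> in_nbhd II i (Suc n)"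
  by (induction n) auto

lemma card_in_nbhd:
  assumes "\<And>i. finite (II i)" "\<And>i. card (II i) \<le> M"
  shows "finite (in_nbhd II i n) \<and> card (in_nbhd II i n) \<le> (1 + M) ^ n"
proof (induction n)
  case (Suc n)
  let ?A = "in_nbhd II i n"
  have "card (\<Union>k\<in>?A. II k) \<le> (\<Sum>k\<in>?A. card (II k))" using Suc by (intro card_UN_le) auto
  also have "\<dots> \<le> card ?A * M" using sum_bounded_above[of ?A "\<lambda>k. card (II k)" M] assms(2) by simp
  finally have "card (in_nbhd II i (Suc n)) \<le> card ?A + card ?A * M"
    using card_Un_le[of ?A "\<Union>k\<in>?A. II k"] by simp
  also have "\<dots> = (1 + M) * card ?A" by (simp add: algebra_simps)
  also have "\<dots> \<le> (1 + M) * (1 + M) ^ n" using Suc by (intro mult_le_mono) auto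
  finally show ?case using Suc assms(1) by simp
qed simp

locale max_gain =
  fixes II :: "'i \<Rightarrow> 'i set" and gam :: "'i \<Rightarrow> 'i \<Rightarrow> real \<Rightarrow> real"
  assumes max_gain_op: "max_gain_op II gam"
begin

abbreviation "T \<equiv> Gam II gam"

abbreviation "traj n r \<equiv> (T ^^ n) (\<lambda>_. r)"

section \<open>Order and equicontinuity estimates uniform over all edges\<close>

lemma fin: "finite (II i)" and gain_Kinf: "j \<in> II i \<Longrightarrow> class_Kinf (gam i j)"
  using max_gain_op unfolding max_gain_op_def by auto

lemma gain_K: "j \<in> II i \<Longrightarrow> class_K (gam i j)"
  using gain_Kinf class_KinfD by auto

lemma T_ge: "j \<in> II i \<Longrightarrow> gam i j (s j) \<le> T s i"
  by (rule Gam_ge[OF fin])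

lemma T_nonneg: "(\<And>i. 0 \<le> s i) \<Longrightarrow> 0 \<le> T s i"
  by (rule Gam_cases[where II=II and i=i and gam=gam and s="s", OF fin]) (auto simp: class_K_nonneg[OF gain_K])

lemma T_le: "0 \<le> c \<Longrightarrow> (\<And>j. j \<in> II i \<Longrightarrow> gam i j (s j) \<le> c) \<Longrightarrow> T s i \<le> c"
  by (rule Gam_cases[where II=II and i=i and gam=gam and s="s", OF fin]) auto

lemma T_mono: "(\<And>i. 0 \<le> s i) \<Longrightarrow> (\<And>i. s i \<le> t i) \<Longrightarrow> T s i \<le> T t i"
proof (rule T_le)
  assume s: "\<And>i. 0 \<le> s i" and st: "\<And>i. s i \<le> t i"
  show "0 \<le> T t i" using s st order_trans by (intro T_nonneg) blast
  fix j assume j: "j \<in> II i"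
  have "gam i j (s j) \<le> gam i j (t j)" by (rule class_K_mono[OF gain_K[OF j] s st])
  then show "gam i j (s j) \<le> T t i" using T_ge[OF j, of t] by simp
qed

lemma gain_unif_cont:
  assumes "0 < e"
  obtains d where "0 < d" "\<And>i j x y. j \<in> II i \<Longrightarrow> 0 \<le> x \<Longrightarrow> x \<le> B \<Longrightarrow> 0 \<le> y \<Longrightarrow> y \<le> B
    \<Longrightarrow> \<bar>x - y\<bar> < d \<Longrightarrow> \<bar>gam i j x - gam i j y\<bar> < e"
proof -
  let ?F = "{gam i j | i j. j \<in> II i}"
  have "\<exists>d>0. \<forall>f\<in>?F. \<forall>y\<in>{0..B}. dist y x < d \<longrightarrow> dist (f y) (f x) < e'"
    if x: "x \<in> {0..B}" and e': "0 < e'" for x e' :: real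
  proof -
    have "0 \<le> x" "0 < e' / 2" using x e' by auto
    then obtain d where "d > 0" and d: "\<And>i j r. j \<in> II i \<Longrightarrow> r \<ge> 0 \<Longrightarrow> \<bar>r - x\<bar> \<le> d \<Longrightarrow> \<bar>gam i j r - gam i j x\<bar> \<le> e' / 2"
      using max_gain_op unfolding max_gain_op_def by meson
    then show ?thesis using e' by (intro exI[of _ d]) (fastforce simp: dist_real_def)
  qed
  then obtain d where d: "d > 0"
      "\<And>f x y. f \<in> ?F \<Longrightarrow> x \<in> {0..B} \<Longrightarrow> y \<in> {0..B} \<Longrightarrow> dist y x < d \<Longrightarrow> dist (f y) (f x) < e"
    by (rule compact_uniformly_equicontinuous[OF compact_Icc _ assms]) blast+
  show thesis
  proof (rule that[OF d(1)])
    fix i j x y assume a: "j \<in> II i" "0 \<le> x" "x \<le> B" "0 \<le> y" "y \<le> B" "\<bar>x - y\<bar> < d"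
    have "gam i j \<in> ?F" using a(1) by blast
    then show "\<bar>gam i j x - gam i j y\<bar> < e"
      using d(2)[of "gam i j" y x] a by (simp add: dist_real_def)
  qed
qed

text \<open>All gains vanish at 0, and by uniform equicontinuity each step of length
  \<open>d/2\<close> raises any of them by less than 1. Finitely many such steps reach
  \<open>B\<close>.\<close>

lemma gain_bounded: "\<exists>C\<ge>0. \<forall>i. \<forall>j\<in>II i. \<forall>x. 0 \<le> x \<and> x \<le> B \<longrightarrow> gam i j x \<le> C"
proof (cases "0 \<le> B")
  case True
  obtain d where d: "0 < d" "\<And>i j x y. j \<in> II i \<Longrightarrow> 0 \<le> x \<Longrightarrow> x \<le> B \<Longrightarrow> 0 \<le> y \<Longrightarrow> y \<le> B
    \<Longrightarrow> \<bar>x - y\<bar> < d \<Longrightarrow> \<bar>gam i j x - gam i j y\<bar> < 1"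
    using gain_unif_cont[of 1 B] zero_less_one by metis
  have *: "gam i j x \<le> real n" if "j \<in> II i" "0 \<le> x" "x \<le> B" "x \<le> real n * (d/2)" for i j x n
    using that
  proof (induction n arbitrary: x)
    case 0
    then show ?case using class_K_zero[OF gain_K] by force
  next
    case (Suc n)
    let ?y = "max 0 (x - d/2)"
    have "0 \<le> real n * (d/2)" using d(1) by simp
    then have "?y \<le> real n * (d/2)" using Suc.prems by (simp add: algebra_simps max_def)
    moreover have y: "0 \<le> ?y" "?y \<le> B" "\<bar>x - ?y\<bar> < d" using Suc.prems d(1) by auto
    ultimately have "gam i j ?y \<le> n" using Suc by blast
    moreover have "\<bar>gam i j x - gam i j ?y\<bar> < 1" using d(2) Suc.prems y by blast
    ultimately show ?case by auto
  qed
  obtain n where "B / (d/2) \<le> real n" using real_arch_simple by blast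
  then have "B \<le> real n * (d/2)" using d(1) by (simp add: field_simps)
  then show ?thesis by (intro exI[of _ "real n"]) (auto intro!: *)
qed auto

lemma T_bounded: "\<exists>C\<ge>0. \<forall>s i. (\<forall>i. 0 \<le> s i \<and> s i \<le> B) \<longrightarrow> T s i \<le> C"
proof -
  obtain C where "0 \<le> C" "\<forall>i. \<forall>j\<in>II i. \<forall>x. 0 \<le> x \<and> x \<le> B \<longrightarrow> gam i j x \<le> C"
    using gain_bounded by blast
  then show ?thesis by (intro exI[of _ C]) (auto intro!: T_le)
qed

lemma T_equicontinuous:
  assumes "0 < e"
  obtains d where "0 < d" "\<And>(s :: 'i \<Rightarrow> real) t i. (\<And>i. 0 \<le> s i \<and> s i \<le> B \<and> 0 \<le> t i \<and> t i \<le> B \<and> \<bar>s i - t i\<bar> < d)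
    \<Longrightarrow> \<bar>T s i - T t i\<bar> \<le> e"
proof -
  obtain d where d: "0 < d" "\<And>i j x y. j \<in> II i \<Longrightarrow> 0 \<le> x \<Longrightarrow> x \<le> B \<Longrightarrow> 0 \<le> y \<Longrightarrow> y \<le> B
    \<Longrightarrow> \<bar>x - y\<bar> < d \<Longrightarrow> \<bar>gam i j x - gam i j y\<bar> < e"
    using gain_unif_cont[OF assms, of B] by metis
  have *: "T s i \<le> T t i + e" if "\<And>i. 0 \<le> s i \<and> s i \<le> B \<and> 0 \<le> t i \<and> t i \<le> B \<and> \<bar>s i - t i\<bar> < d" for s t :: "'i \<Rightarrow> real" and i
  proof (rule T_le)
    show "0 \<le> T t i + e" using T_nonneg[of t] that assms by (simp add: less_imp_le)
    fix j assume j: "j \<in> II i"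
    then have "\<bar>gam i j (s j) - gam i j (t j)\<bar> < e" using d(2)[OF j, of "s j" "t j"] that by blast
    moreover have "gam i j (t j) \<le> T t i" by (rule T_ge[OF j])
    ultimately show "gam i j (s j) \<le> T t i + e" by linarith
  qed
  show thesis
  proof (rule that[OF d(1)])
    fix s t :: "'i \<Rightarrow> real" and i assume a: "\<And>i. 0 \<le> s i \<and> s i \<le> B \<and> 0 \<le> t i \<and> t i \<le> B \<and> \<bar>s i - t i\<bar> < d"
    show "\<bar>T s i - T t i\<bar> \<le> e"
      using *[of s t i] *[of t s i] a by (fastforce simp: abs_minus_commute)
  qed
qed

section \<open>Iterates and trajectories of constant vectors\<close>

lemma iter_nonneg: "(\<And>i. 0 \<le> s i) \<Longrightarrow> 0 \<le> (T ^^ n) s i"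
  by (induction n arbitrary: i) (auto intro: T_nonneg)

lemma iter_mono: "(\<And>i. 0 \<le> s i) \<Longrightarrow> (\<And>i. s i \<le> t i) \<Longrightarrow> (T ^^ n) s i \<le> (T ^^ n) t i"
  by (induction n arbitrary: i) (auto intro: T_mono iter_nonneg)

lemma iter_bounded: "\<exists>C\<ge>0. \<forall>s i. (\<forall>i. 0 \<le> s i \<and> s i \<le> B) \<longrightarrow> (T ^^ n) s i \<le> C"
proof (induction n)
  case 0
  show ?case by (intro exI[of _ "max 0 B"]) (auto simp: le_max_iff_disj)
next
  case (Suc n)
  then obtain C where C: "0 \<le> C" "\<forall>s i. (\<forall>i. 0 \<le> s i \<and> s i \<le> B) \<longrightarrow> (T ^^ n) s i \<le> C" by blast
  obtain D where D: "0 \<le> D" "\<forall>s i. (\<forall>i. 0 \<le> s i \<and> s i \<le> C) \<longrightarrow> T s i \<le> D" using T_bounded by blast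
  show ?case
  proof (intro exI[of _ D] conjI allI impI)
    fix s :: "'i \<Rightarrow> real" and i assume s: "\<forall>i. 0 \<le> s i \<and> s i \<le> B"
    then have "\<forall>i. 0 \<le> (T ^^ n) s i \<and> (T ^^ n) s i \<le> C" using C iter_nonneg by auto
    then show "(T ^^ Suc n) s i \<le> D" using D by auto
  qed (rule D)
qed

lemma lpos_iter: assumes "lpos s" shows "lpos ((T ^^ n) s)"
proof -
  obtain C where C: "\<forall>t i. (\<forall>i. 0 \<le> t i \<and> t i \<le> lnorm s) \<longrightarrow> (T ^^ n) t i \<le> C"
    using iter_bounded by meson
  then show ?thesis
    using assms by (intro lposI[of _ C] iter_nonneg) (auto simp: lposD lpos_le_lnorm)
qed

lemma traj_equicontinuous:
  assumes "0 \<le> r0" "0 < e"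
  shows "\<exists>d>0. \<forall>r\<ge>0. \<bar>r - r0\<bar> < d \<longrightarrow> (\<forall>i. \<bar>traj n r i - traj n r0 i\<bar> \<le> e)"
  using assms(2)
proof (induction n arbitrary: e)
  case 0
  then show ?case by (auto intro: less_imp_le)
next
  case (Suc n)
  obtain C where C: "\<forall>s i. (\<forall>i. 0 \<le> s i \<and> s i \<le> r0 + 1) \<longrightarrow> (T ^^ n) s i \<le> C"
    using iter_bounded by meson
  obtain d where d: "0 < d" "\<And>(s :: 'i \<Rightarrow> real) t i. (\<And>i. 0 \<le> s i \<and> s i \<le> C \<and> 0 \<le> t i \<and> t i \<le> C \<and> \<bar>s i - t i\<bar> < d)
    \<Longrightarrow> \<bar>T s i - T t i\<bar> \<le> e"
    using T_equicontinuous[OF Suc.prems, of C] by metis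
  obtain d' where d': "0 < d'" "\<forall>r\<ge>0. \<bar>r - r0\<bar> < d' \<longrightarrow> (\<forall>i. \<bar>traj n r i - traj n r0 i\<bar> \<le> d / 2)"
    using Suc.IH[of "d/2"] d(1) by auto
  show ?case
  proof (intro exI[of _ "min 1 d'"] conjI allI impI)
    fix r i assume r: "0 \<le> r" "\<bar>r - r0\<bar> < min 1 d'"
    have "0 \<le> traj n r i \<and> traj n r i \<le> C \<and> 0 \<le> traj n r0 i \<and> traj n r0 i \<le> C \<and> \<bar>traj n r i - traj n r0 i\<bar> < d" for i
    proof (intro conjI)
      show "\<bar>traj n r i - traj n r0 i\<bar> < d"
        using d'(2)[rule_format, of r i] r d(1) by linarith
    qed (use r assms C in \<open>auto intro!: iter_nonneg\<close>)
    then show "\<bar>traj (Suc n) r i - traj (Suc n) r0 i\<bar> \<le> e" using d(2) by simp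
  qed (use d' in auto)
qed

lemma traj_zero: "traj n 0 i = (0::real)"
proof (induction n arbitrary: i)
  case (Suc n)
  then have "traj n 0 = (\<lambda>_. 0)" by auto
  moreover have "T (\<lambda>_. 0) i = 0"
    by (rule Gam_cases[where II=II and i=i and gam=gam and s="\<lambda>_. 0", OF fin]) (auto simp: class_K_zero[OF gain_K])
  ultimately show ?case by simp
qed auto

text \<open>Constant initial vectors suffice, since \<open>T\<close> is monotone and every family
  lies below the constant vector of its norm. Stability is not part of the notion: each iterate is
  equicontinuous at 0, and attraction takes care of all but finitely many iterates.\<close>

definition "attractive \<longleftrightarrow> (\<forall>R>0. \<forall>e>0. \<exists>N. \<forall>n\<ge>N. \<forall>i. traj n R i \<le> e)"

lemma traj_nonneg: "0 \<le> r \<Longrightarrow> 0 \<le> traj n r i"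
  by (rule iter_nonneg) simp

lemma traj_mono: "0 \<le> r \<Longrightarrow> r \<le> s \<Longrightarrow> traj n r i \<le> traj n s i"
  by (rule iter_mono) auto

lemma attractive_KL:
  assumes "attractive"
  shows "\<exists>\<beta>. class_KL \<beta> \<and> (\<forall>n i. \<forall>r\<ge>0. traj n r i \<le> \<beta> r (real n))"
proof (rule KL_majorant[where f = "\<lambda>n i r. traj n r i"])
  show "\<exists>B. \<forall>i. traj n R i \<le> B" if "0 \<le> R" for n R
    using iter_bounded[of R n] that by (metis order_refl)
  show "\<exists>d>0. \<forall>i. traj n d i \<le> e" if e: "0 < e" for n e
  proof -
    obtain d where d: "0 < d" "\<forall>r\<ge>0. \<bar>r - 0\<bar> < d \<longrightarrow> (\<forall>i. \<bar>traj n r i - traj n 0 i\<bar> \<le> e)"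
      using traj_equicontinuous[OF order_refl e, of n] by blast
    have "traj n (d/2) i \<le> e" for i using d(2)[rule_format, of "d/2" i] d(1) traj_zero[of n i] by auto
    then show ?thesis using d(1) by (intro exI[of _ "d/2"]) auto
  qed
  show "\<exists>N. \<forall>n\<ge>N. \<forall>k. traj n R k \<le> e" if "0 < R" "0 < e" for R e
    using assms that unfolding attractive_def by blast
qed (auto simp: traj_zero intro: traj_mono)

lemma UGAS_iff_attractive: "UGAS T \<longleftrightarrow> attractive"
proof
  assume "attractive"
  then obtain \<beta> where \<beta>: "class_KL \<beta>" "\<And>n i r. 0 \<le> r \<Longrightarrow> traj n r i \<le> \<beta> r (real n)"
    using attractive_KL by blast
  have "lnorm ((T ^^ n) s) \<le> \<beta> (lnorm s) (real n)" if s: "lpos s" for s n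
  proof (rule lnorm_le)
    show "0 \<le> (T ^^ n) s i" for i by (rule iter_nonneg[OF lposD[OF s]])
    show "(T ^^ n) s i \<le> \<beta> (lnorm s) (real n)" for i
      using iter_mono[of s "\<lambda>_. lnorm s" n i] lposD[OF s] lpos_le_lnorm[OF s] \<beta>(2)[OF lnorm_nonneg[OF s], of n i]
      by (meson order_trans)
  qed
  then show "UGAS T" unfolding UGAS_def using \<beta>(1) by blast
next
  assume "UGAS T"
  then obtain \<beta> where \<beta>: "class_KL \<beta>" "\<And>s n. lpos s \<Longrightarrow> lnorm ((T ^^ n) s) \<le> \<beta> (lnorm s) (real n)"
    unfolding UGAS_def by blast
  show "attractive"
    unfolding attractive_def
  proof (intro allI impI)
    fix R e :: real assume R: "0 < R" and e: "0 < e"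
    have "(\<beta> R \<longlongrightarrow> 0) at_top" using \<beta>(1) R unfolding class_KL_def by blast
    then have "\<forall>\<^sub>F t in at_top. \<beta> R t < e" using e by (rule order_tendstoD)
    then obtain t0 where t0: "\<And>t. t0 \<le> t \<Longrightarrow> \<beta> R t < e" unfolding eventually_at_top_linorder by blast
    show "\<exists>N. \<forall>n\<ge>N. \<forall>i. traj n R i \<le> e"
    proof (intro exI[of _ "nat \<lceil>t0\<rceil>"] allI impI)
      fix n i assume n: "nat \<lceil>t0\<rceil> \<le> n"
      have l: "lpos (\<lambda>_::'i. R)" using R by (intro lposI[of _ R]) auto
      have "traj n R i \<le> lnorm (traj n R)" by (rule lpos_le_lnorm[OF lpos_iter[OF l]])
      also have "\<dots> \<le> \<beta> R (real n)" using \<beta>(2)[OF l, of n] R by (simp add: lnorm_const)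
      also have "\<dots> < e" using n by (intro t0) linarith
      finally show "traj n R i \<le> e" by simp
    qed
  qed
qed

text \<open>The KL bound at time 0 dominates all later times. It is only of class K, and the summand
  \<open>r\<close> makes it unbounded.\<close>

lemma attractive_Kinf:
  assumes "attractive"
  shows "\<exists>\<kappa>. class_Kinf \<kappa> \<and> (\<forall>n i. \<forall>r\<ge>0. traj n r i \<le> \<kappa> r)"
proof -
  obtain \<beta> where \<beta>: "class_KL \<beta>" "\<And>n i r. 0 \<le> r \<Longrightarrow> traj n r i \<le> \<beta> r (real n)"
    using attractive_KL[OF assms] by blast
  have K: "class_K (\<lambda>r. \<beta> r 0)" using \<beta>(1) unfolding class_KL_def by simp
  have "\<beta> r (real n) \<le> \<beta> r 0" if "0 \<le> r" for r n
  proof (cases "r = 0")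
    case True
    have "class_K (\<lambda>r. \<beta> r (real n))" using \<beta>(1) unfolding class_KL_def by simp
    then show ?thesis using True class_K_zero[OF K] class_K_zero[of "\<lambda>r. \<beta> r (real n)"] by simp
  next
    case False
    then have "\<forall>t1 t2. 0 \<le> t1 \<longrightarrow> t1 < t2 \<longrightarrow> \<beta> r t2 < \<beta> r t1" using \<beta>(1) that unfolding class_KL_def by simp
    then show ?thesis by (cases "n = 0") (auto intro: less_imp_le)
  qed
  then have "traj n r i \<le> \<beta> r 0 + r" if "0 \<le> r" for n i r
    using \<beta>(2)[OF that, of n i] that by (smt (verit))
  moreover have "class_Kinf (\<lambda>r. \<beta> r 0 + r)"
  proof (rule class_KinfI)
    show "continuous_on {0..} (\<lambda>r. \<beta> r 0 + r)" using K unfolding class_K_def by (auto intro: continuous_intros)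
    show "\<beta> r 0 + r < \<beta> s 0 + s" if "0 \<le> r" "r < s" for r s using class_K_less[OF K that] that by simp
    show "\<beta> 0 0 + 0 = 0" using class_K_zero[OF K] by simp
    show "\<exists>r\<ge>0. M < \<beta> r 0 + r" for M
      using class_K_nonneg[OF K, of "max 0 M + 1"] by (intro exI[of _ "max 0 M + 1"]) auto
  qed
  ultimately show ?thesis by blast
qed

text \<open>Each gain depends on one coordinate \<open>j\<close> and is continuous, so an
  \<open>n\<close> that nearly attains the supremum in that coordinate alone nearly attains the
  value of the gain. Different \<open>j\<close> may use different \<open>n\<close>, and therefore
  the sequence can be arbitrary apart from its bounds.\<close>

lemma T_SUP_le:
  fixes u :: "nat \<Rightarrow> 'i \<Rightarrow> real"
  assumes u: "\<And>n i. 0 \<le> u n i" "\<And>n i. u n i \<le> C"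
  shows "T (\<lambda>i. SUP n. u n i) i \<le> (SUP n. T (u n) i)"
proof (rule T_le)
  have bu: "bdd_above (range (\<lambda>n. u n j))" for j by (rule bdd_aboveI2) (rule u)
  obtain D where D: "\<forall>s i. (\<forall>i. 0 \<le> s i \<and> s i \<le> C) \<longrightarrow> T s i \<le> D" using T_bounded by meson
  then have "T (u n) i \<le> D" for n using u by simp
  then have bT: "bdd_above (range (\<lambda>n. T (u n) i))" by (rule bdd_aboveI2)
  show "0 \<le> (SUP n. T (u n) i)"
    using cSUP_upper[OF UNIV_I bT, of 0] T_nonneg[of "u 0" i] u by force
  fix j assume j: "j \<in> II i"
  note K = gain_K[OF j]
  let ?x = "SUP n. u n j"
  show "gam i j ?x \<le> (SUP n. T (u n) i)"
  proof (rule field_le_epsilon)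
    fix e :: real assume e: "0 < e"
    have ux: "u n j \<le> ?x" for n by (rule cSUP_upper[OF UNIV_I bu])
    then have x0: "0 \<le> ?x" using u(1)[of 0 j] order_trans by blast
    obtain d where d: "0 < d" "\<And>r. 0 \<le> r \<Longrightarrow> \<bar>r - ?x\<bar> \<le> d \<Longrightarrow> \<bar>gam i j r - gam i j ?x\<bar> \<le> e"
      using class_K_cont[OF K x0 e] by metis
    have "?x - d < ?x" using d by simp
    then obtain n where n: "?x - d < u n j" using less_cSUP_iff[OF _ bu[of j], of "?x - d"] by auto
    have "\<bar>gam i j (u n j) - gam i j ?x\<bar> \<le> e" using d(2)[of "u n j"] u n ux[of n] by auto
    moreover have "gam i j (u n j) \<le> T (u n) i" by (rule T_ge[OF j])
    moreover have "T (u n) i \<le> (SUP n. T (u n) i)" by (rule cSUP_upper[OF UNIV_I bT])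
    ultimately show "gam i j ?x \<le> (SUP n. T (u n) i) + e" by linarith
  qed
qed

text \<open>A real supremum, meaningful only for bounded trajectories; this explains the bound
  \<open>C\<close> in \<open>traj_le_Q\<close>, \<open>Q_ge\<close> and
  \<open>T_Q_le\<close>.\<close>

definition "Q r i = (SUP n. traj n r i)"

lemma traj_le_Q: "(\<And>n i. traj n r i \<le> C) \<Longrightarrow> traj n r i \<le> Q r i"
  unfolding Q_def by (rule cSUP_upper[OF UNIV_I bdd_aboveI2])

lemma Q_le: "(\<And>n. traj n r i \<le> B) \<Longrightarrow> Q r i \<le> B"
  unfolding Q_def by (rule cSUP_least) auto

lemma Q_ge: "(\<And>n i. traj n r i \<le> C) \<Longrightarrow> r \<le> Q r i"
  using traj_le_Q[of r C 0 i] by simp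

text \<open>Applying \<open>T\<close> to every term shifts the trajectory by one, so the supremum
  only loses its term with \<open>n = 0\<close>.\<close>

lemma T_Q_le:
  assumes "0 \<le> r" "\<And>n i. traj n r i \<le> C"
  shows "T (Q r) i \<le> Q r i"
proof -
  have "T (Q r) i \<le> (SUP n. T (traj n r) i)"
    unfolding Q_def[abs_def] by (rule T_SUP_le) (auto intro: traj_nonneg assms)
  also have "\<dots> \<le> Q r i"
  proof (rule cSUP_least)
    show "T (traj n r) i \<le> Q r i" for n
      using traj_le_Q[of r C "Suc n" i] assms(2) by simp
  qed simp
  finally show ?thesis .
qed

lemma Q_equicontinuous:
  assumes attr: "attractive" and r0: "0 < r0" and e: "0 < e"
  shows "\<exists>d>0. \<forall>r>0. \<bar>r - r0\<bar> < d \<longrightarrow> (\<forall>i. \<bar>Q r i - Q r0 i\<bar> \<le> e)"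
proof -
  obtain \<kappa> where \<kappa>: "\<And>n i r. 0 \<le> r \<Longrightarrow> traj n r i \<le> \<kappa> r" using attractive_Kinf[OF attr] by blast
  \<comment> \<open>The radius \<open>2 * r0\<close> dominates and the tolerance
    \<open>r0 / 2\<close> is dominated by every \<open>r\<close> within \<open>r0 / 2\<close> of
    \<open>r0\<close>, so one \<open>N\<close> serves all of them.\<close>
  obtain N where N: "\<And>n i. N \<le> n \<Longrightarrow> traj n (2 * r0) i \<le> r0 / 2"
    using attr[unfolded attractive_def, rule_format, of "2 * r0" "r0 / 2"] r0 by auto
  have "\<exists>d>0. \<forall>r\<ge>0. \<bar>r - r0\<bar> < d \<longrightarrow> (\<forall>i. \<bar>traj n r i - traj n r0 i\<bar> \<le> e)" for n
    using traj_equicontinuous[of r0 e n] r0 e by auto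
  then obtain d where d: "\<And>n. 0 < d n" "\<And>n r i. 0 \<le> r \<Longrightarrow> \<bar>r - r0\<bar> < d n \<Longrightarrow> \<bar>traj n r i - traj n r0 i\<bar> \<le> e"
    by metis
  define D where "D = Min (insert (r0 / 2) (d ` {..N}))"
  have D: "0 < D" "D \<le> r0 / 2" "\<And>n. n \<le> N \<Longrightarrow> D \<le> d n"
  proof -
    show "0 < D" unfolding D_def using d(1) r0 by auto
    show "D \<le> r0 / 2" "\<And>n. n \<le> N \<Longrightarrow> D \<le> d n" unfolding D_def by (rule Min_le; simp)+
  qed
  have close: "\<bar>traj n r i - traj n r0 i\<bar> \<le> e" if "0 \<le> r" "\<bar>r - r0\<bar> < D" "n \<le> N" for n r i
    using d(2)[OF that(1)] that D(3)[OF that(3)] by auto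
  \<comment> \<open>For \<open>r\<close> near \<open>r0\<close>, the terms with \<open>n \<ge> N\<close> lie below the term with \<open>n = 0\<close>.\<close>
  have half: "Q r i \<le> Q r' i + e" if r: "r / 2 < r0" "r0 / 2 \<le> r'" "0 \<le> r" "r0 / 2 \<le> r"
    and c: "\<And>n. n \<le> N \<Longrightarrow> \<bar>traj n r i - traj n r' i\<bar> \<le> e" for r r' i
  proof (rule Q_le)
    fix n
    have r': "0 \<le> r'" using r r0 by auto
    have tq: "traj n r' i \<le> Q r' i" for n by (rule traj_le_Q[OF \<kappa>[OF r']])
    show "traj n r i \<le> Q r' i + e"
    proof (cases "n \<le> N")
      case True
      then show ?thesis using c[OF True] tq[of n] by linarith
    next
      case False
      have "traj n r i \<le> traj n (2 * r0) i" using r by (intro traj_mono) auto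
      also have "\<dots> \<le> r0 / 2" using False by (intro N) auto
      also have "\<dots> \<le> r'" using r by simp
      also have "\<dots> \<le> Q r' i" using tq[of 0] by simp
      finally show ?thesis using e by simp
    qed
  qed
  show ?thesis
  proof (intro exI[of _ D] conjI allI impI)
    fix r i assume r: "0 < r" "\<bar>r - r0\<bar> < D"
    have b: "r0 / 2 \<le> r" "r / 2 < r0" using r D r0 by linarith+
    have "Q r i \<le> Q r0 i + e" using b r r0 by (intro half close) auto
    moreover have "Q r0 i \<le> Q r i + e"
    proof (rule half)
      show "\<bar>traj n r0 i - traj n r i\<bar> \<le> e" if "n \<le> N" for n
        using close[OF _ r(2) that, of i] r by (simp add: abs_minus_commute)
    qed (use b r r0 in auto)
    ultimately show "\<bar>Q r i - Q r0 i\<bar> \<le> e" by linarith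
  qed (rule D)
qed

section \<open>Enlarged gain operators and paths of strict decay\<close>

text \<open>Equicontinuity survives the composition with \<open>\<rho>\<close> because near
  \<open>r0\<close> all gains take values in one compact interval, on which \<open>\<rho>\<close> is
  uniformly continuous.\<close>

lemma max_gain_boost:
  assumes \<rho>: "class_Kinf \<rho>"
  shows "max_gain II (boost \<rho> gam)"
proof
  note \<rho>K = class_KinfD[OF \<rho>]
  have 1: "class_Kinf (boost \<rho> gam i j)" if j: "j \<in> II i" for i j
    unfolding boost_def by (intro class_Kinf_add class_Kinf_compose[OF \<rho>] gain_Kinf[OF j])
  have 2: "\<exists>\<delta>>0. \<forall>i. \<forall>j\<in>II i. \<forall>r\<ge>0. \<bar>r - r0\<bar> \<le> \<delta> \<longrightarrow> \<bar>boost \<rho> gam i j r - boost \<rho> gam i j r0\<bar> \<le> e"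
    if r0: "0 \<le> r0" and e: "0 < e" for r0 e :: real
  proof -
    obtain C where C: "0 \<le> C" "\<And>i j x. j \<in> II i \<Longrightarrow> 0 \<le> x \<Longrightarrow> x \<le> r0 + 1 \<Longrightarrow> gam i j x \<le> C"
      using gain_bounded[of "r0 + 1"] by blast
    have "continuous_on {0..C} \<rho>" using \<rho>K unfolding class_K_def by (auto elim: continuous_on_subset)
    then have "uniformly_continuous_on {0..C} \<rho>" by (rule compact_uniformly_continuous) simp
    moreover have "0 < e / 2" using e by simp
    ultimately obtain d where d: "0 < d" "\<And>x y. x \<in> {0..C} \<Longrightarrow> y \<in> {0..C} \<Longrightarrow> dist y x < d \<Longrightarrow> dist (\<rho> y) (\<rho> x) < e / 2"
      unfolding uniformly_continuous_on_def by meson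
    have "0 < min (e / 2) (d / 2)" using d(1) e by simp
    then have "\<exists>d'>0. \<forall>i. \<forall>j\<in>II i. \<forall>r\<ge>0. \<bar>r - r0\<bar> \<le> d' \<longrightarrow> \<bar>gam i j r - gam i j r0\<bar> \<le> min (e / 2) (d / 2)"
      using max_gain_op r0 unfolding max_gain_op_def by blast
    then obtain d' where d': "0 < d'" "\<And>i j r. j \<in> II i \<Longrightarrow> 0 \<le> r \<Longrightarrow> \<bar>r - r0\<bar> \<le> d' \<Longrightarrow> \<bar>gam i j r - gam i j r0\<bar> \<le> min (e / 2) (d / 2)"
      by blast
    show ?thesis
    proof (intro exI[of _ "min 1 d'"] conjI allI ballI impI)
      fix i j r assume a: "j \<in> II i" "0 \<le> (r::real)" "\<bar>r - r0\<bar> \<le> min 1 d'"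
      have g: "\<bar>gam i j r - gam i j r0\<bar> \<le> e / 2" "\<bar>gam i j r - gam i j r0\<bar> \<le> d / 2"
        using d'(2)[OF a(1,2)] a(3) by auto
      have "r \<le> r0 + 1" using a(3) by linarith
      then have mem: "gam i j r \<in> {0..C}" "gam i j r0 \<in> {0..C}"
        using C(2)[OF a(1,2)] C(2)[OF a(1) r0] class_K_nonneg[OF gain_K[OF a(1)] a(2)]
          class_K_nonneg[OF gain_K[OF a(1)] r0] by simp_all
      have "dist (\<rho> (gam i j r)) (\<rho> (gam i j r0)) < e / 2"
        by (rule d(2)[OF mem(2,1)]) (use g d(1) in \<open>simp add: dist_real_def\<close>)
      then show "\<bar>boost \<rho> gam i j r - boost \<rho> gam i j r0\<bar> \<le> e"
        using g unfolding boost_def dist_real_def by linarith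
    qed (use d' in auto)
  qed
  show "max_gain_op II (boost \<rho> gam)"
    unfolding max_gain_op_def
  proof (intro conjI)
    show "\<forall>i. finite (II i) \<and> i \<notin> II i" using max_gain_op unfolding max_gain_op_def by simp
  qed (simp_all add: 1 2)
qed

lemma Gam_rho_eq:
  assumes \<rho>: "class_K \<rho>" and s: "\<And>i. 0 \<le> s i"
  shows "Gam_rho II gam \<rho> s i = Gam II (boost \<rho> gam) s i"
proof (rule antisym)
  show "Gam_rho II gam \<rho> s i \<le> Gam II (boost \<rho> gam) s i"
  proof (rule Gam_cases[where II = II and i = i and gam = gam and s = s, OF fin])
    assume a: "II i = {}" "T s i = 0"
    then show ?thesis using class_K_zero[OF \<rho>] unfolding Gam_rho_def by (simp add: Gam_def)
  next
    fix j assume "j \<in> II i" "T s i = gam i j (s j)"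
    then show ?thesis
      using Gam_ge[where II = II and gam = "boost \<rho> gam" and s = s, OF fin] unfolding Gam_rho_def boost_def by force
  qed
  show "Gam II (boost \<rho> gam) s i \<le> Gam_rho II gam \<rho> s i"
  proof (rule Gam_cases[where II = II and i = i and gam = "boost \<rho> gam" and s = s, OF fin])
    assume "Gam II (boost \<rho> gam) s i = 0"
    then show ?thesis
      using T_nonneg[where i=i, OF s] class_K_nonneg[OF \<rho>, of "T s i"] unfolding Gam_rho_def by simp
  next
    fix j assume j: "j \<in> II i" "Gam II (boost \<rho> gam) s i = boost \<rho> gam i j (s j)"
    have "gam i j (s j) \<le> T s i" by (rule T_ge[OF j(1)])
    moreover have "\<rho> (gam i j (s j)) \<le> \<rho> (T s i)"
      using calculation class_K_nonneg[OF gain_K[OF j(1)] s] by (intro class_K_mono[OF \<rho>]) auto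
    ultimately have "boost \<rho> gam i j (s j) \<le> Gam_rho II gam \<rho> s i"
      unfolding Gam_rho_def boost_def by simp
    then show ?thesis using j(2) by simp
  qed
qed

lemma Gam_rho_iter:
  assumes \<rho>: "class_Kinf \<rho>" and s: "\<And>i. 0 \<le> s i"
  shows "(Gam_rho II gam \<rho> ^^ n) s = (Gam II (boost \<rho> gam) ^^ n) s"
proof (induction n)
  case (Suc n)
  interpret B: max_gain II "boost \<rho> gam" by (rule max_gain_boost[OF \<rho>])
  have "Gam_rho II gam \<rho> ((B.T ^^ n) s) = B.T ((B.T ^^ n) s)"
    by (rule ext, rule Gam_rho_eq[OF class_KinfD[OF \<rho>] B.iter_nonneg[OF s]])
  then show ?case by (simp add: Suc)
qed simp

lemma UGAS_Gam_rho:
  assumes "class_Kinf \<rho>"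
  shows "UGAS (Gam_rho II gam \<rho>) \<longleftrightarrow> max_gain.attractive II (boost \<rho> gam)"
proof -
  interpret B: max_gain II "boost \<rho> gam" by (rule max_gain_boost[OF assms])
  have "UGAS (Gam_rho II gam \<rho>) \<longleftrightarrow> UGAS B.T"
  proof -
    have "(Gam_rho II gam \<rho> ^^ n) s = (B.T ^^ n) s" if "lpos s" for s n
      by (rule Gam_rho_iter[OF assms lposD[OF that]])
    then show ?thesis unfolding UGAS_def by simp
  qed
  then show ?thesis by (simp add: B.UGAS_iff_attractive)
qed

lemma attractive_imp_path:
  assumes \<rho>: "class_Kinf \<rho>" and attr: "max_gain.attractive II (boost \<rho> gam)"
  shows "\<exists>\<sigma>. path_strict_decay II gam \<sigma>"
proof -
  note \<rho>K = class_KinfD[OF \<rho>]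
  interpret B: max_gain II "boost \<rho> gam" by (rule max_gain_boost[OF \<rho>])
  \<comment> \<open>Both parts of the minimum serve the gap \<open>g\<close>. Let x be a component
    of T(Q). If x <= r/4, the cap \<open>\<rho>' x \<le> x\<close> keeps \<open>C.T\<close> below
    r/2, hence at least r/2 below Q. If x > r/4, using only half of \<open>\<rho>\<close> leaves the
    slack \<open>\<rho> (r/4) / 2\<close>. The function \<open>g\<close> is the minimum of these two
    margins.\<close>
  define \<rho>' where "\<rho>' x = min x (\<rho> x * (1/2))" for x
  have \<rho>': "class_Kinf \<rho>'"
    unfolding \<rho>'_def[abs_def] by (intro class_Kinf_min class_Kinf_scale \<rho> class_Kinf_id) simp
  interpret C: max_gain II "boost \<rho>' gam" by (rule max_gain_boost[OF \<rho>'])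
  define g where "g r = min r (\<rho> (r * (1/4))) * (1/2)" for r :: real
  have g: "class_Kinf g"
    unfolding g_def[abs_def]
    by (intro class_Kinf_min class_Kinf_scale class_Kinf_compose[OF \<rho>] class_Kinf_id) simp_all
  obtain \<kappa> where \<kappa>: "class_Kinf \<kappa>" "\<And>n i r. 0 \<le> r \<Longrightarrow> B.traj n r i \<le> \<kappa> r"
    using B.attractive_Kinf[OF attr] by blast
  note \<kappa>K = class_KinfD[OF \<kappa>(1)]
  let ?Q = "B.Q"
  have Qge: "r \<le> ?Q r i" if "0 \<le> r" for r i by (rule B.Q_ge[OF \<kappa>(2)[OF that]])
  have Qnn: "0 \<le> ?Q r i" if "0 \<le> r" for r i using Qge[OF that, of i] that by simp
  have Qle: "?Q r i \<le> \<kappa> r" if "0 \<le> r" for r i by (rule B.Q_le[OF \<kappa>(2)[OF that]])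
  have Qmono: "?Q r i \<le> ?Q s i" if "0 \<le> r" "r \<le> s" for r s i
  proof (rule B.Q_le)
    have s: "0 \<le> s" using that by simp
    show "B.traj n r i \<le> ?Q s i" for n
      using B.traj_mono[OF that, of n i] B.traj_le_Q[OF \<kappa>(2)[OF s], of n i] by linarith
  qed
  have BQ: "B.T (?Q r) i \<le> ?Q r i" if "0 \<le> r" for r i by (rule B.T_Q_le[OF that \<kappa>(2)[OF that]])
  have T_eq: "B.T s i = T s i + \<rho> (T s i)" "C.T s i = T s i + \<rho>' (T s i)" if "\<And>i. 0 \<le> s i" for s i
    using Gam_rho_eq[where i=i, OF \<rho>K that] Gam_rho_eq[where i=i, OF class_KinfD[OF \<rho>'] that] unfolding Gam_rho_def by simp_all
  \<comment> \<open>The term \<open>r * (1/2)\<close> bounds the path from below by a K_oo function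
    even where \<open>C.T (?Q r)\<close> is small or zero.\<close>
  define P where "P i r = max (r * (1/2)) (C.T (?Q r) i)" for i r
  have Pg: "P i r + g r \<le> ?Q r i" if r: "0 < r" for i r
  proof -
    let ?x = "T (?Q r) i"
    have x0: "0 \<le> ?x" using Qnn r by (intro T_nonneg) auto
    have xQ: "?x + \<rho> ?x \<le> ?Q r i" using BQ[of r i] T_eq(1)[of "?Q r" i] Qnn r by auto
    have g1: "g r \<le> r * (1/2)" "g r \<le> \<rho> (r * (1/4)) * (1/2)" unfolding g_def by auto
    have h: "r * (1/2) + g r \<le> ?Q r i" using Qge[of r i] g1 r by auto
    moreover have "C.T (?Q r) i + g r \<le> ?Q r i"
    proof (cases "?x \<le> r * (1/4)")
      case True
      have "\<rho>' ?x \<le> ?x" unfolding \<rho>'_def by simp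
      then show ?thesis using True h T_eq(2)[of "?Q r" i] Qnn r by auto
    next
      case False
      then have "\<rho> (r * (1/4)) \<le> \<rho> ?x" using r by (intro class_K_mono[OF \<rho>K]) auto
      moreover have "\<rho>' ?x \<le> \<rho> ?x * (1/2)" unfolding \<rho>'_def by simp
      ultimately show ?thesis using g1 xQ T_eq(2)[of "?Q r" i] Qnn r by auto
    qed
    ultimately show ?thesis unfolding P_def by simp
  qed
  have "\<exists>S. (\<forall>i. \<forall>r>0. P i r \<le> S i r \<and> S i r \<le> P i r + g r) \<and>
    (\<forall>a>0. \<forall>b. \<exists>l>0. \<exists>L\<ge>l. \<forall>i s r. a \<le> s \<longrightarrow> s \<le> r \<longrightarrow> r \<le> b \<longrightarrow>
      l * (r - s) \<le> S i r - S i s \<and> S i r - S i s \<le> L * (r - s))"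
  proof (rule bi_Lipschitz_sandwich[OF _ _ _ \<kappa>(1) g])
    show "P i s \<le> P i r" if "0 < s" "s \<le> r" for i s r
      unfolding P_def using that Qmono Qnn by (intro max.mono C.T_mono) auto
    show "0 \<le> P i r \<and> P i r \<le> \<kappa> r" if r: "0 < r" for i r
      using Pg[OF r, of i] Qle[of r i] class_K_nonneg[OF class_KinfD[OF g], of r] r unfolding P_def by auto
    fix r0 e :: real assume r0: "0 < r0" and e: "0 < e"
    \<comment> \<open>\<open>\<kappa> (r0 + 1)\<close> is a common bound for \<open>?Q s\<close>
      over all \<open>s\<close> within distance 1 of \<open>r0\<close>, as the equicontinuity of
      \<open>C.T\<close> requires.\<close>
    obtain d where d: "0 < d" "\<And>(s :: 'i \<Rightarrow> real) t i.
        (\<And>i. 0 \<le> s i \<and> s i \<le> \<kappa> (r0 + 1) \<and> 0 \<le> t i \<and> t i \<le> \<kappa> (r0 + 1) \<and> \<bar>s i - t i\<bar> < d) \<Longrightarrow> \<bar>C.T s i - C.T t i\<bar> \<le> e"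
      using C.T_equicontinuous[OF e, of "\<kappa> (r0 + 1)"] by metis
    obtain d' where d': "0 < d'" "\<And>r i. 0 < r \<Longrightarrow> \<bar>r - r0\<bar> < d' \<Longrightarrow> \<bar>?Q r i - ?Q r0 i\<bar> \<le> d / 2"
      using B.Q_equicontinuous[OF attr r0, of "d / 2"] d(1) by auto
    show "\<exists>d>0. \<forall>s>0. \<bar>s - r0\<bar> < d \<longrightarrow> (\<forall>i. \<bar>P i s - P i r0\<bar> \<le> e)"
    proof (intro exI[of _ "min (min 1 d') e"] conjI allI impI)
      fix s i assume s: "0 < s" "\<bar>s - r0\<bar> < min (min 1 d') e"
      have "\<bar>C.T (?Q s) i - C.T (?Q r0) i\<bar> \<le> e"
      proof (rule d(2), intro conjI)
        fix i
        show "0 \<le> ?Q s i" "0 \<le> ?Q r0 i" using Qnn s r0 by auto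
        show "?Q s i \<le> \<kappa> (r0 + 1)" "?Q r0 i \<le> \<kappa> (r0 + 1)"
          using s r0 by (auto intro!: order_trans[OF Qle class_K_mono[OF \<kappa>K]])
        show "\<bar>?Q s i - ?Q r0 i\<bar> < d" using d'(2)[of s i] s d(1) by auto
      qed
      moreover have "\<bar>s * (1/2) - r0 * (1/2)\<bar> \<le> e" using s by auto
      ultimately show "\<bar>P i s - P i r0\<bar> \<le> e" unfolding P_def by linarith
    qed (use d' e in auto)
  qed
  then obtain S where S': "\<forall>i. \<forall>r>0. P i r \<le> S i r \<and> S i r \<le> P i r + g r"
    and lip': "\<forall>a>0. \<forall>b. \<exists>l>0. \<exists>L\<ge>l. \<forall>i s r. a \<le> s \<longrightarrow> s \<le> r \<longrightarrow> r \<le> b \<longrightarrow>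
      l * (r - s) \<le> S i r - S i s \<and> S i r - S i s \<le> L * (r - s)"
    by (elim exE conjE) (rule that)
  have S: "P i r \<le> S i r \<and> S i r \<le> P i r + g r" if "0 < r" for i r using S' that by simp
  note lip = lip'[THEN spec, THEN mp, THEN spec]
  have SQ: "S i r \<le> ?Q r i" if "0 < r" for i r using S[OF that, of i] Pg[OF that, of i] by simp
  have bound: "r * (1/2) \<le> S i r \<and> S i r \<le> \<kappa> r" if "0 < r" for i r
    using S[OF that, of i] SQ[OF that, of i] Qle[of r i] that unfolding P_def by auto
  have half: "class_Kinf (\<lambda>r. r * (1/2))" by (intro class_Kinf_scale class_Kinf_id) simp
  define \<sigma> where "\<sigma> = (\<lambda>r i. if r \<le> 0 then 0 else S i r)"
  note fam = bi_Lipschitz_Kinf_family[where S = S and ?\<phi>1.0 = "\<lambda>r. r * (1/2)" and ?\<phi>2.0 = \<kappa>, OF bound half \<kappa>(1) lip]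
  have \<sigma>_bound: "r * (1/2) \<le> \<sigma> r i" "\<sigma> r i \<le> \<kappa> r" if "0 \<le> r" for r i
    using bound[of r i] that class_K_zero[OF \<kappa>K] unfolding \<sigma>_def by auto
  have decay: "Gam_rho II gam \<rho>' (\<sigma> r) i \<le> \<sigma> r i" if r: "0 \<le> r" for r i
  proof -
    have \<sigma>0: "0 \<le> \<sigma> r i" for i using \<sigma>_bound(1)[OF r, of i] r by simp
    show ?thesis
    proof (cases "r = 0")
      case True
      then have "\<sigma> r = (\<lambda>_. 0)" unfolding \<sigma>_def by auto
      then show ?thesis using C.traj_zero[of 1 i] Gam_rho_eq[OF class_KinfD[OF \<rho>'], of "\<lambda>_. 0" i] by simp
    next
      case False
      then have r0: "0 < r" using r by simp
      have "Gam_rho II gam \<rho>' (\<sigma> r) i = C.T (\<sigma> r) i" by (rule Gam_rho_eq[OF class_KinfD[OF \<rho>'] \<sigma>0])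
      also have "\<dots> \<le> C.T (?Q r) i" using \<sigma>0 SQ[OF r0] r0 unfolding \<sigma>_def by (intro C.T_mono) auto
      also have "\<dots> \<le> P i r" unfolding P_def by simp
      also have "\<dots> \<le> \<sigma> r i" using S[OF r0, of i] r0 unfolding \<sigma>_def by simp
      finally show ?thesis .
    qed
  qed
  have "path_strict_decay II gam \<sigma>"
    unfolding path_strict_decay_def
  proof (intro conjI allI impI)
    show "\<exists>\<rho>. class_Kinf \<rho> \<and> (\<forall>r\<ge>0. Gam_rho II gam \<rho> (\<sigma> r) \<le> \<sigma> r)"
      using \<rho>' decay by (intro exI[of _ \<rho>']) (auto simp: le_fun_def)
    show "\<exists>\<phi>min \<phi>max. class_Kinf \<phi>min \<and> class_Kinf \<phi>max \<and> (\<forall>r\<ge>0. \<forall>i. \<phi>min r \<le> \<sigma> r i \<and> \<sigma> r i \<le> \<phi>max r)"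
      using half \<kappa>(1) \<sigma>_bound by blast
    show "class_Kinf (\<lambda>r. \<sigma> r i)" for i unfolding \<sigma>_def by (rule fam(1))
    fix K :: "real set" assume K: "compact K \<and> K \<subseteq> {0<..}"
    show "\<exists>l L. 0 < l \<and> l \<le> L \<and> (\<forall>r1\<in>K. \<forall>r2\<in>K. \<forall>i.
           l * \<bar>r1 - r2\<bar> \<le> \<bar>inv_into {0..} (\<lambda>r. \<sigma> r i) r1 - inv_into {0..} (\<lambda>r. \<sigma> r i) r2\<bar> \<and>
           \<bar>inv_into {0..} (\<lambda>r. \<sigma> r i) r1 - inv_into {0..} (\<lambda>r. \<sigma> r i) r2\<bar> \<le> L * \<bar>r1 - r2\<bar>)"
      unfolding \<sigma>_def by (rule fam(2)) (use K in auto)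
  qed
  then show ?thesis by blast
qed

text \<open>The slack lowers each component by a fixed amount. The lower slope bound of the inverses
  converts this, uniformly in the index, into a fixed decrease of the curve parameter, so that one
  scalar controls the whole trajectory.\<close>

lemma path_imp_attractive:
  assumes path: "path_strict_decay II gam \<sigma>"
  shows "\<exists>\<rho>'. class_Kinf \<rho>' \<and> max_gain.attractive II (boost \<rho>' gam)"
proof -
  note path' = path[unfolded path_strict_decay_def]
  from path'[THEN conjunct1] obtain \<rho> where \<rho>: "class_Kinf \<rho>"
    and decay: "\<And>r. 0 \<le> r \<Longrightarrow> Gam_rho II gam \<rho> (\<sigma> r) \<le> \<sigma> r"
    by auto
  from path'[THEN conjunct2, THEN conjunct1] obtain \<phi>1 \<phi>2 where \<phi>: "class_Kinf \<phi>1" "class_Kinf \<phi>2"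
    and \<phi>_bound: "\<And>r i. 0 \<le> r \<Longrightarrow> \<phi>1 r \<le> \<sigma> r i \<and> \<sigma> r i \<le> \<phi>2 r"
    by auto
  note \<sigma> = path'[THEN conjunct2, THEN conjunct2, THEN conjunct1, THEN spec]
  note \<rho>K = class_KinfD[OF \<rho>] and \<sigma>K = class_KinfD[OF \<sigma>] and K1 = class_KinfD[OF \<phi>(1)] and K2 = class_KinfD[OF \<phi>(2)]
  let ?inv = "\<lambda>i. inv_into {0..} (\<lambda>r. \<sigma> r i)"
  have lip: "\<exists>l>0. \<forall>r1\<in>K. \<forall>r2\<in>K. \<forall>i. l * \<bar>r1 - r2\<bar> \<le> \<bar>?inv i r1 - ?inv i r2\<bar>"
    if "compact K" "K \<subseteq> {0<..}" for K
    using path'[THEN conjunct2, THEN conjunct2, THEN conjunct2, THEN spec, of K] that by blast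
  define \<rho>' where "\<rho>' x = min x (\<rho> x * (1/2))" for x
  have \<rho>': "class_Kinf \<rho>'"
    unfolding \<rho>'_def[abs_def] by (intro class_Kinf_min class_Kinf_scale \<rho> class_Kinf_id) simp
  interpret C: max_gain II "boost \<rho>' gam" by (rule max_gain_boost[OF \<rho>'])
  have \<sigma>0: "0 \<le> \<sigma> r i" if "0 \<le> r" for r i by (rule class_K_nonneg[OF \<sigma>K that])
  have T_eq: "C.T s i = T s i + \<rho>' (T s i)" if "\<And>i. 0 \<le> s i" for s i
    using Gam_rho_eq[where i=i, OF class_KinfD[OF \<rho>'] that] unfolding Gam_rho_def by simp
  have T_path: "T (\<sigma> r) i + \<rho> (T (\<sigma> r) i) \<le> \<sigma> r i" if "0 \<le> r" for r i
    using decay[OF that] unfolding Gam_rho_def le_fun_def by blast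
  have step: "\<exists>c>0. \<forall>r i. a \<le> r \<longrightarrow> r \<le> b \<longrightarrow> C.T (\<sigma> r) i \<le> \<sigma> (r - c) i \<and> c \<le> r"
    if a: "0 < a" "a \<le> b" for a b
  proof -
    \<comment> \<open>For \<open>a \<le> r\<close> every component of the path is at least
      \<open>m\<close>. If T is at most \<open>m / 4\<close> there, the capped
      \<open>\<rho>'\<close> keeps \<open>C.T\<close> below \<open>m / 2\<close>; otherwise the
      slack is at least \<open>\<rho> (m / 4) / 2\<close>. Either way the drop is at least
      \<open>d\<close>, and the new value stays above \<open>m / 2\<close>, inside the compact set
      used for the slope bound.\<close>
    define m where "m = \<phi>1 a"
    define d where "d = min (m / 2) (\<rho> (m / 4) / 2)"
    have m: "0 < m" unfolding m_def by (rule class_K_pos[OF K1 a(1)])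
    have d: "0 < d" unfolding d_def using m class_K_pos[OF \<rho>K, of "m/4"] by auto
    have "\<exists>l>0. \<forall>r1\<in>{m/2..\<phi>2 b}. \<forall>r2\<in>{m/2..\<phi>2 b}. \<forall>i. l * \<bar>r1 - r2\<bar> \<le> \<bar>?inv i r1 - ?inv i r2\<bar>"
      by (rule lip) (use m in auto)
    then obtain l where l: "0 < l" "\<And>r1 r2 i. r1 \<in> {m/2..\<phi>2 b} \<Longrightarrow> r2 \<in> {m/2..\<phi>2 b} \<Longrightarrow>
        l * \<bar>r1 - r2\<bar> \<le> \<bar>?inv i r1 - ?inv i r2\<bar>"
      by blast
    \<comment> \<open>A drop \<open>d\<close> of the value is a drop of at least
      \<open>l * d\<close> of the parameter; the minimum with \<open>a\<close> keeps
      \<open>r - c\<close> nonnegative.\<close>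
    define c where "c = min (l * d) a"
    have c: "0 < c" "c \<le> a" "c \<le> l * d" unfolding c_def using l d a by auto
    have "C.T (\<sigma> r) i \<le> \<sigma> (r - c) i" if r: "a \<le> r" "r \<le> b" for r i
    proof -
      have r0: "0 \<le> r" using r a by simp
      let ?x = "T (\<sigma> r) i"
      have x: "?x + \<rho> ?x \<le> \<sigma> r i" by (rule T_path[OF r0])
      have "m \<le> \<phi>1 r" unfolding m_def using r a by (intro class_K_mono[OF K1]) auto
      then have sm: "m \<le> \<sigma> r i" using \<phi>_bound[OF r0, of i] by simp
      have "\<phi>2 r \<le> \<phi>2 b" using r r0 by (intro class_K_mono[OF K2]) auto
      then have sb: "\<sigma> r i \<le> \<phi>2 b" using \<phi>_bound[OF r0, of i] by simp
      define z where "z = \<sigma> r i - d"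
      have dm: "d \<le> m / 2" "d \<le> \<rho> (m / 4) / 2" unfolding d_def by auto
      have "?x + \<rho>' ?x \<le> z"
      proof (cases "?x \<le> m / 4")
        case True
        then show ?thesis using dm sm unfolding z_def \<rho>'_def by auto
      next
        case False
        then have "\<rho> (m / 4) \<le> \<rho> ?x" using m by (intro class_K_mono[OF \<rho>K]) auto
        moreover have "\<rho>' ?x \<le> \<rho> ?x * (1/2)" unfolding \<rho>'_def by simp
        ultimately show ?thesis using x dm unfolding z_def by auto
      qed
      then have Cz: "C.T (\<sigma> r) i \<le> z" using T_eq[of "\<sigma> r" i] \<sigma>0[OF r0] by simp
      have zK: "z \<in> {m/2..\<phi>2 b}" "\<sigma> r i \<in> {m/2..\<phi>2 b}" using sm sb dm d m unfolding z_def by auto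
      have z0: "0 \<le> z" using zK m by simp
      note I = class_Kinf_inv[OF \<sigma> z0, of i]
      have s0: "0 \<le> \<sigma> r i" using sm m by simp
      note J = class_Kinf_inv[OF \<sigma> s0, of i]
      have inv_r: "?inv i (\<sigma> r i) = r"
        using class_K_less[OF \<sigma>K J(1), of r i] class_K_less[OF \<sigma>K r0, of "?inv i (\<sigma> r i)" i] J(2) by (cases "?inv i (\<sigma> r i)" r rule: linorder_cases) auto
      have less: "?inv i z < r"
      proof (rule ccontr)
        assume "\<not> ?inv i z < r"
        then have "\<sigma> r i \<le> z" using class_K_mono[OF \<sigma>K r0, of "?inv i z" i] I(2) by simp
        then show False using d unfolding z_def by simp
      qed
      have "l * \<bar>\<sigma> r i - z\<bar> \<le> \<bar>?inv i (\<sigma> r i) - ?inv i z\<bar>" by (rule l(2)[OF zK(2,1)])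
      then have "l * d \<le> r - ?inv i z" unfolding inv_r using less d unfolding z_def by simp
      then have "?inv i z \<le> r - c" using c by simp
      then have "z \<le> \<sigma> (r - c) i" using class_K_mono[OF \<sigma>K I(1), of "r - c" i] I(2) by simp
      then show ?thesis using Cz by simp
    qed
    then show ?thesis using c by (intro exI[of _ c]) (auto intro: order_trans)
  qed
  have "C.attractive"
    unfolding C.attractive_def
  proof (intro allI impI)
    fix R e :: real assume R: "0 < R" and e: "0 < e"
    obtain a0 where a0: "0 < a0" "\<phi>2 a0 \<le> e" using class_K_small[OF K2 e] by blast
    obtain b where b: "0 \<le> b" "R < \<phi>1 b" using \<phi>(1) unfolding class_Kinf_def by blast
    have b0: "0 < b" using b R class_K_zero[OF K1] by (cases "b = 0") auto
    define a where "a = min a0 b"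
    have a: "0 < a" "a \<le> b" "a \<le> a0" unfolding a_def using a0 b0 by auto
    obtain c where c: "0 < c" "\<And>r i. a \<le> r \<Longrightarrow> r \<le> b \<Longrightarrow> C.T (\<sigma> r) i \<le> \<sigma> (r - c) i \<and> c \<le> r"
      using step[OF a(1,2)] by blast
    \<comment> \<open>The parameter starts at \<open>b\<close>, where the path lies above the
      constant \<open>R\<close>, and falls by \<open>c\<close> per step until it reaches the floor
      \<open>a\<close>.\<close>
    have main: "C.traj n R i \<le> \<sigma> (max a (b - real n * c)) i" for n i
    proof (induction n arbitrary: i)
      case 0
      then show ?case using a \<phi>_bound[OF b(1), of i] b by (simp add: max_def)
    next
      case (Suc n)
      let ?r = "max a (b - real n * c)"
      have r: "a \<le> ?r" "?r \<le> b" using a c by auto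
      have "C.traj (Suc n) R i \<le> C.T (\<sigma> ?r) i"
        using Suc.IH C.traj_nonneg[of R n] R by (auto intro!: C.T_mono)
      also have "\<dots> \<le> \<sigma> (?r - c) i" using c(2)[OF r] by blast
      also have "\<dots> \<le> \<sigma> (max a (b - real (Suc n) * c)) i"
        using c(2)[OF r, of i] c(1) by (intro class_K_mono[OF \<sigma>K]) (auto simp: algebra_simps max_def)
      finally show ?case .
    qed
    obtain N where N: "b / c \<le> real N" using real_arch_simple by blast
    show "\<exists>N. \<forall>n\<ge>N. \<forall>i. C.traj n R i \<le> e"
    proof (intro exI[of _ N] allI impI)
      fix n i assume "N \<le> n"
      then have "b / c \<le> real n" using N by (meson of_nat_le_iff order_trans)
      then have "b - real n * c \<le> a" using c(1) a by (simp add: field_simps)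
      then have "C.traj n R i \<le> \<sigma> a i" using main[of n i] by (simp add: max_absorb1)
      also have "\<dots> \<le> \<phi>2 a" using \<phi>_bound[of a i] a by simp
      also have "\<dots> \<le> \<phi>2 a0" using a by (intro class_K_mono[OF K2]) auto
      finally show "C.traj n R i \<le> e" using a0 by simp
    qed
  qed
  then show ?thesis using \<rho>' by blast
qed

section \<open>The uniform NJI condition\<close>

text \<open>Equicontinuity at 0 read backwards: a small argument would force a small value. It
  transports a lower bound from the head of an edge to its tail, with one constant for all
  edges.\<close>

lemma gain_lower:
  assumes "0 < e"
  shows "\<exists>d>0. \<forall>i. \<forall>j\<in>II i. \<forall>x\<ge>0. e \<le> gam i j x \<longrightarrow> d \<le> x"
proof -
  obtain d where d: "0 < d" "\<And>i j x y. j \<in> II i \<Longrightarrow> 0 \<le> x \<Longrightarrow> x \<le> 1 \<Longrightarrow> 0 \<le> y \<Longrightarrow> y \<le> 1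
    \<Longrightarrow> \<bar>x - y\<bar> < d \<Longrightarrow> \<bar>gam i j x - gam i j y\<bar> < e"
    using gain_unif_cont[OF assms, of 1] by metis
  have "min 1 d \<le> x" if "j \<in> II i" "0 \<le> x" "e \<le> gam i j x" for i j x
  proof (rule ccontr)
    assume "\<not> min 1 d \<le> x"
    then have "\<bar>gam i j x - gam i j 0\<bar> < e" using that by (intro d(2)) auto
    then show False using that class_K_zero[OF gain_K[OF that(1)]] by simp
  qed
  then show ?thesis using d(1) by (intro exI[of _ "min 1 d"]) auto
qed

text \<open>If \<open>k\<close> attains the maximum at \<open>i\<close>, then
  \<open>e \<le> s i \<le> gam i k (s k)\<close> forces \<open>s k\<close> above the threshold
  \<open>d1\<close>, so the induction hypothesis applies at \<open>k\<close>. The thresholds depend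
  only on \<open>e\<close> and \<open>n\<close>, and their minimum along the path becomes the
  \<open>\<delta>\<close> of the NJI condition.\<close>

lemma no_decrease_iter:
  assumes "0 < e"
  shows "\<exists>d>0. \<forall>s i. (\<forall>i. 0 \<le> s i) \<longrightarrow> e \<le> s i \<longrightarrow>
    (\<forall>j\<in>in_nbhd II i n. d \<le> s j \<longrightarrow> s j \<le> T s j) \<longrightarrow> s i \<le> (T ^^ n) s i"
  using assms
proof (induction n arbitrary: e)
  case 0
  then show ?case by (intro exI[of _ 1]) simp
next
  case (Suc n)
  obtain d1 where d1: "0 < d1" "\<And>i j x. j \<in> II i \<Longrightarrow> 0 \<le> x \<Longrightarrow> e \<le> gam i j x \<Longrightarrow> d1 \<le> x"
    using gain_lower[OF Suc.prems] by blast
  obtain d where d: "0 < d" "\<And>s i. (\<forall>i. 0 \<le> s i) \<Longrightarrow> d1 \<le> s i \<Longrightarrow>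
    (\<forall>j\<in>in_nbhd II i n. d \<le> s j \<longrightarrow> s j \<le> T s j) \<Longrightarrow> s i \<le> (T ^^ n) s i"
    using Suc.IH[OF d1(1)] by blast
  show ?case
  proof (intro exI[of _ "min d e"] conjI allI impI)
    fix s :: "'i \<Rightarrow> real" and i
    assume s: "\<forall>i. 0 \<le> s i" and e: "e \<le> s i"
      and nd: "\<forall>j\<in>in_nbhd II i (Suc n). min d e \<le> s j \<longrightarrow> s j \<le> T s j"
    have si: "s i \<le> T s i" using nd in_nbhd_self[of i II "Suc n"] e by (simp only: min_le_iff_disj) blast
    show "s i \<le> (T ^^ Suc n) s i"
    proof (rule Gam_cases[where II = II and i = i and gam = gam and s = s, OF fin])
      assume "T s i = 0"
      then show ?thesis using si e Suc.prems by simp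
    next
      fix k assume k: "k \<in> II i" "T s i = gam i k (s k)"
      have "d1 \<le> s k" using d1(2)[OF k(1), of "s k"] s k(2) si e by simp
      moreover have "\<forall>j\<in>in_nbhd II k n. d \<le> s j \<longrightarrow> s j \<le> T s j"
        using nd in_nbhd_step[of k II i n] k(1) by (meson min.coboundedI1 subsetD)
      ultimately have "s k \<le> (T ^^ n) s k" using d(2) s by blast
      then have "gam i k (s k) \<le> gam i k ((T ^^ n) s k)" using s by (intro class_K_mono[OF gain_K[OF k(1)]]) auto
      also have "\<dots> \<le> T ((T ^^ n) s) i" by (rule T_ge[OF k(1)])
      finally show ?thesis using k(2) si by simp
    qed
  qed (use d Suc.prems in auto)
qed

lemma attractive_imp_NJI:
  assumes "attractive"
  shows "uniform_NJI II T"
  unfolding uniform_NJI_def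
proof (intro allI impI)
  fix r e :: real assume r: "0 < r" and e: "0 < e"
  \<comment> \<open>The depth of the neighbourhood is the time after which trajectories from norm
    \<open>r\<close> are below \<open>e / 2\<close>; the threshold \<open>d\<close> is chosen after
    it.\<close>
  obtain n where n: "\<And>i. traj n r i \<le> e / 2"
    using assms r e unfolding attractive_def by (meson half_gt_zero order_refl)
  obtain d where d: "0 < d" "\<And>s i. (\<forall>i. 0 \<le> s i) \<Longrightarrow> e \<le> s i \<Longrightarrow>
    (\<forall>j\<in>in_nbhd II i n. d \<le> s j \<longrightarrow> s j \<le> T s j) \<Longrightarrow> s i \<le> (T ^^ n) s i"
    using no_decrease_iter[OF e, of n] by blast
  have "\<exists>j\<in>in_nbhd II i n. d \<le> s j \<and> T s j < s j" if "lpos s \<and> e \<le> s i \<and> lnorm s \<le> r" for s i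
  proof (rule ccontr)
    assume "\<not> (\<exists>j\<in>in_nbhd II i n. d \<le> s j \<and> T s j < s j)"
    then have nd: "\<forall>j\<in>in_nbhd II i n. d \<le> s j \<longrightarrow> s j \<le> T s j" by (auto simp: not_less)
    have s: "\<forall>i. 0 \<le> s i" using that by (auto intro: lposD)
    have "s i \<le> (T ^^ n) s i" using d(2)[OF s _ nd] that by blast
    also have "\<dots> \<le> traj n r i"
    proof (rule iter_mono)
      show "s j \<le> r" for j using that lpos_le_lnorm[of s j] by linarith
    qed (use s in blast)
    also have "\<dots> \<le> e / 2" by (rule n)
    finally show False using that e by simp
  qed
  then show "\<exists>n. \<exists>\<delta>>0. \<forall>s i. lpos s \<and> e \<le> s i \<and> lnorm s \<le> r \<longrightarrow> (\<exists>j\<in>in_nbhd II i n. \<delta> \<le> s j \<and> T s j < s j)"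
    using d(1) by blast
qed

lemma attractive_imp_bounded:
  assumes "attractive"
  shows "bounded_trajectories T"
  unfolding bounded_trajectories_def
proof (intro allI impI)
  fix s :: "'i \<Rightarrow> real" assume s: "lpos s"
  obtain \<kappa> where \<kappa>: "\<And>n i r. 0 \<le> r \<Longrightarrow> traj n r i \<le> \<kappa> r" using attractive_Kinf[OF assms] by blast
  have "lnorm ((T ^^ n) s) \<le> \<kappa> (lnorm s)" for n
  proof (rule lnorm_le)
    show "0 \<le> (T ^^ n) s i" for i by (rule iter_nonneg[OF lposD[OF s]])
    have "(T ^^ n) s i \<le> traj n (lnorm s) i" for i by (rule iter_mono[OF lposD[OF s] lpos_le_lnorm[OF s]])
    then show "(T ^^ n) s i \<le> \<kappa> (lnorm s)" for i
      using \<kappa>[OF lnorm_nonneg[OF s], of n i] order_trans by blast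
  qed
  then show "\<exists>C. \<forall>n. lnorm ((T ^^ n) s) \<le> C" by blast
qed

section \<open>From the uniform NJI condition back to attractivity\<close>

lemma NJI_Gam_rho:
  assumes "class_K \<rho>"
  shows "uniform_NJI II (Gam_rho II gam \<rho>) \<longleftrightarrow> uniform_NJI II (Gam II (boost \<rho> gam))"
proof -
  have "Gam_rho II gam \<rho> s j = Gam II (boost \<rho> gam) s j" if "lpos s" for s j
    by (rule Gam_rho_eq[OF assms lposD[OF that]])
  then show ?thesis unfolding uniform_NJI_def by (simp cong: conj_cong)
qed

lemma bounded_Gam_rho:
  assumes "class_Kinf \<rho>"
  shows "bounded_trajectories (Gam_rho II gam \<rho>) \<longleftrightarrow> bounded_trajectories (Gam II (boost \<rho> gam))"
proof -
  have "(Gam_rho II gam \<rho> ^^ n) s = (Gam II (boost \<rho> gam) ^^ n) s" if "lpos s" for s n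
    by (rule Gam_rho_iter[OF assms lposD[OF that]])
  then show ?thesis unfolding bounded_trajectories_def by simp
qed

text \<open>The NJI condition alone gives a strict inequality without any amount. Passing to half of
  \<open>\<rho>\<close> makes the drop quantitative, and starting from the supersolution
  \<open>Q\<close> makes the sequence \<open>s\<close> nonincreasing, so drops at different times in
  the same neighbourhood add up.\<close>

lemma NJI_imp_attractive:
  assumes \<rho>: "class_Kinf \<rho>"
    and bdd: "bounded_trajectories (Gam_rho II gam \<rho>)"
    and NJI: "uniform_NJI II (Gam_rho II gam \<rho>)"
    and card: "\<And>i. card (II i) \<le> M"
  shows "max_gain.attractive II (boost (\<lambda>x. \<rho> x * (1/2)) gam)"
proof -
  note \<rho>K = class_KinfD[OF \<rho>]
  interpret B: max_gain II "boost \<rho> gam" by (rule max_gain_boost[OF \<rho>])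
  define \<rho>' where "\<rho>' = (\<lambda>x. \<rho> x * (1/2))"
  have \<rho>': "class_Kinf \<rho>'" unfolding \<rho>'_def by (rule class_Kinf_scale[OF \<rho>]) simp
  interpret C: max_gain II "boost \<rho>' gam" by (rule max_gain_boost[OF \<rho>'])
  have T_eq: "B.T s i = T s i + \<rho> (T s i)" "C.T s i = T s i + \<rho> (T s i) / 2" if "\<And>i. 0 \<le> s i" for s i
    using Gam_rho_eq[where i = i, OF \<rho>K that] Gam_rho_eq[where i = i, OF class_KinfD[OF \<rho>'] that]
    unfolding Gam_rho_def \<rho>'_def by simp_all
  have "C.attractive"
    unfolding C.attractive_def
  proof (intro allI impI)
    fix R e :: real assume R: "0 < R" and e: "0 < e"
    have lR: "lpos (\<lambda>_::'i. R)" using R by (intro lposI[of _ R]) auto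
    obtain C0 where C0: "\<And>n. lnorm (B.traj n R) \<le> C0"
      using bdd[unfolded bounded_Gam_rho[OF \<rho>]] lR unfolding bounded_trajectories_def by blast
    have BC: "B.traj n R i \<le> C0" for n i
      using lpos_le_lnorm[OF B.lpos_iter[OF lR], of n i] C0[of n] by linarith
    have C0R: "0 < C0" using BC[of 0] R by simp
    let ?Q = "B.Q R"
    have QR: "R \<le> ?Q i" for i by (rule B.Q_ge[OF BC])
    have QC: "?Q i \<le> C0" for i by (rule B.Q_le[OF BC])
    have Q0: "0 \<le> ?Q i" for i using QR[of i] R by simp
    define s where "s m = (C.T ^^ m) ?Q" for m
    have s0: "0 \<le> s m i" for m i unfolding s_def by (rule C.iter_nonneg[OF Q0])
    have s_Suc: "s (Suc m) = C.T (s m)" for m unfolding s_def by simp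
    have s_dec: "s (Suc m) i \<le> s m i" for m i
    proof (induction m arbitrary: i)
      case 0
      have "C.T ?Q i \<le> B.T ?Q i"
        using T_eq[of ?Q i] Q0 class_K_nonneg[OF \<rho>K T_nonneg[where i = i, OF Q0]] by simp
      also have "\<dots> \<le> ?Q i" by (rule B.T_Q_le[OF less_imp_le[OF R] BC])
      finally show ?case unfolding s_def by simp
    next
      case (Suc m)
      show ?case unfolding s_Suc[of "Suc m"] s_Suc[of m] by (rule C.T_mono) (use Suc s0 s_Suc in metis)+
    qed
    have s_mono: "s n i \<le> s m i" if "m \<le> n" for m n i
      using that by (induction n rule: dec_induct) (auto intro: order_trans[OF s_dec])
    have sC: "s m i \<le> C0" for m i
      using s_mono[of 0 m i] QC[of i] unfolding s_def by simp
    have traj_s: "C.traj m R i \<le> s m i" for m i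
      unfolding s_def using QR R by (intro C.iter_mono) auto
    have "uniform_NJI II B.T" using NJI NJI_Gam_rho[OF \<rho>K] by simp
    from this[unfolded uniform_NJI_def, THEN spec, THEN mp, OF C0R, THEN spec, THEN mp, OF e]
    obtain n0 d where d: "0 < d" and nji: "\<forall>s i. lpos s \<and> e \<le> s i \<and> lnorm s \<le> C0 \<longrightarrow>
      (\<exists>j\<in>in_nbhd II i n0. d \<le> s j \<and> B.T s j < s j)"
      by (elim exE conjE) (rule that)
    \<comment> \<open>A threshold for the component T of \<open>s m\<close> at \<open>j\<close>,
      where \<open>s m j \<ge> d\<close>. Below \<open>x0\<close> the value of \<open>C.T\<close> is
      at most \<open>d / 4\<close>, which is already a drop of more than \<open>d / 2\<close>. Above
      it, \<open>B.T\<close> exceeds \<open>C.T\<close> by at least \<open>\<rho> x0 / 2\<close>.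
      The constant \<open>\<xi>\<close> is the smaller of the two amounts.\<close>
    obtain x0 where x0: "0 < x0" "x0 + \<rho> x0 / 2 \<le> d / 4"
      using class_K_small[OF class_KinfD[OF class_Kinf_add[OF class_Kinf_id \<rho>']], of "d/4"] d unfolding \<rho>'_def by auto
    define \<xi> where "\<xi> = min (d / 2) (\<rho> x0 / 2)"
    have \<xi>: "0 < \<xi>" "\<xi> \<le> d / 2" "\<xi> \<le> \<rho> x0 / 2" unfolding \<xi>_def using d class_K_pos[OF \<rho>K x0(1)] by auto
    have finN: "finite (in_nbhd II i n0)" "card (in_nbhd II i n0) \<le> (1 + M) ^ n0" for i
      using card_in_nbhd[of II M i n0] fin card by auto
    \<comment> \<open>A decrease smaller than \<open>\<xi>\<close> of \<open>C.T\<close> at a coordinate above \<open>d\<close> would mean no decrease of \<open>B.T\<close>.\<close>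
    have drop: "\<xi> \<le> s m j - s (Suc m) j" if j: "d \<le> s m j" "B.T (s m) j < s m j" for m j
    proof (rule ccontr)
      assume a: "\<not> \<xi> \<le> s m j - s (Suc m) j"
      let ?x = "T (s m) j"
      have x: "s (Suc m) j = ?x + \<rho> ?x / 2" "B.T (s m) j = ?x + \<rho> ?x"
        unfolding s_Suc using T_eq[of "s m" j] s0 by auto
      have "x0 \<le> ?x"
      proof (rule ccontr)
        assume "\<not> x0 \<le> ?x"
        then have "\<rho> ?x \<le> \<rho> x0" using T_nonneg[of "s m" j] s0 by (intro class_K_mono[OF \<rho>K]) auto
        then have "?x + \<rho> ?x / 2 \<le> d / 4" using \<open>\<not> x0 \<le> ?x\<close> x0(2) by linarith
        then show False using a x(1) j(1) \<xi>(2) d by linarith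
      qed
      then have "\<rho> x0 \<le> \<rho> ?x" using x0(1) by (intro class_K_mono[OF \<rho>K]) auto
      then show False using a x j(2) \<xi>(3) by linarith
    qed
    \<comment> \<open>The sum over the neighbourhood of \<open>i\<close> acts as a potential. Since
      \<open>s\<close> is nonincreasing, \<open>e \<le> s m i\<close> also holds at all earlier
      times, and each of those steps costs the potential at least \<open>\<xi>\<close>.\<close>
    have total: "real m * \<xi> + (\<Sum>j\<in>in_nbhd II i n0. s m j) \<le> (\<Sum>j\<in>in_nbhd II i n0. s 0 j)"
      if "e \<le> s m i" for m i
      using that
    proof (induction m)
      case (Suc m)
      let ?N = "in_nbhd II i n0"
      have em: "e \<le> s m i" using Suc.prems s_dec[of m i] by linarith
      have "lpos (s m)" by (rule lposI[OF s0 sC])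
      then obtain j where j: "j \<in> ?N" "d \<le> s m j" "B.T (s m) j < s m j"
        using nji[THEN spec, of "s m", THEN spec, of i] em lnorm_le[of "s m" C0, OF s0 sC] by blast
      have "\<xi> \<le> s m j - s (Suc m) j" by (rule drop[OF j(2,3)])
      also have "\<dots> \<le> (\<Sum>j\<in>?N. s m j - s (Suc m) j)"
        by (rule member_le_sum[OF j(1)]) (use s_dec finN in auto)
      finally have "\<xi> + (\<Sum>j\<in>?N. s (Suc m) j) \<le> (\<Sum>j\<in>?N. s m j)" by (simp add: sum_subtractf)
      then show ?case using Suc.IH[OF em] by (simp add: algebra_simps)
    qed simp
    \<comment> \<open>Bounds the initial potential for every \<open>i\<close> at once, so the number
      of steps spent above \<open>e\<close> does not depend on the index.\<close>
    define K where "K = real ((1 + M) ^ n0) * C0"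
    have K: "real m * \<xi> \<le> K" if "e \<le> s m i" for m i
    proof -
      have "(\<Sum>j\<in>in_nbhd II i n0. s 0 j) \<le> real (card (in_nbhd II i n0)) * C0"
        by (rule sum_bounded_above) (rule sC)
      also have "\<dots> \<le> K" unfolding K_def by (rule mult_right_mono[OF of_nat_mono[OF finN(2)] less_imp_le[OF C0R]])
      finally show ?thesis
        using total[OF that] sum_nonneg[of "in_nbhd II i n0" "s m", OF s0] by linarith
    qed
    obtain P where P: "K / \<xi> < real P" using reals_Archimedean2 by blast
    show "\<exists>N. \<forall>n\<ge>N. \<forall>i. C.traj n R i \<le> e"
    proof (intro exI[of _ P] allI impI)
      fix n i assume "P \<le> n"
      then have "K / \<xi> < real n" using P by (meson less_le_trans of_nat_le_iff)
      then have "K < real n * \<xi>" using \<xi>(1) by (simp add: field_simps)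
      then have "s n i < e" using K[of n i] by linarith
      then show "C.traj n R i \<le> e" using traj_s[of n i] by linarith
    qed
  qed
  then show ?thesis unfolding \<rho>'_def .
qed

end

theorem theorem4p1:
  fixes II :: "'i::countable \<Rightarrow> 'i set"
    and gam :: "'i \<Rightarrow> 'i \<Rightarrow> real \<Rightarrow> real"
  assumes "max_gain_op II gam"
  shows "((\<exists>\<sigma>. path_strict_decay II gam \<sigma>) \<longleftrightarrow>
           (\<exists>\<rho>. class_Kinf \<rho> \<and> UGAS (Gam_rho II gam \<rho>))) \<and>
         (assumption_A II gam \<and> (\<exists>M>0. \<forall>i. real (card (II i)) \<le> M) \<longrightarrow>
           ((\<exists>\<sigma>. path_strict_decay II gam \<sigma>) \<longleftrightarrow>
            (\<exists>\<rho>. class_Kinf \<rho> \<and> bounded_trajectories (Gam_rho II gam \<rho>) \<and>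
                  uniform_NJI II (Gam_rho II gam \<rho>))))"
proof -
  interpret max_gain II gam by standard (rule assms)
  have ab: "(\<exists>\<sigma>. path_strict_decay II gam \<sigma>) \<longleftrightarrow> (\<exists>\<rho>. class_Kinf \<rho> \<and> UGAS (Gam_rho II gam \<rho>))"
    using path_imp_attractive attractive_imp_path UGAS_Gam_rho by metis
  have bc: "\<exists>\<rho>. class_Kinf \<rho> \<and> bounded_trajectories (Gam_rho II gam \<rho>) \<and> uniform_NJI II (Gam_rho II gam \<rho>)"
    if \<rho>: "class_Kinf \<rho>" and UGAS: "UGAS (Gam_rho II gam \<rho>)" for \<rho>
  proof -
    interpret B: max_gain II "boost \<rho> gam" by (rule max_gain_boost[OF \<rho>])
    have attr: "B.attractive" using UGAS UGAS_Gam_rho[OF \<rho>] by simp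
    show ?thesis
      using \<rho> B.attractive_imp_bounded[OF attr] B.attractive_imp_NJI[OF attr]
        bounded_Gam_rho[OF \<rho>] NJI_Gam_rho[OF class_KinfD[OF \<rho>]] by blast
  qed
  have cb: "\<exists>\<rho>. class_Kinf \<rho> \<and> UGAS (Gam_rho II gam \<rho>)"
    if M: "\<forall>i. real (card (II i)) \<le> M" and \<rho>: "class_Kinf \<rho>"
      and c: "bounded_trajectories (Gam_rho II gam \<rho>)" "uniform_NJI II (Gam_rho II gam \<rho>)" for M \<rho>
  proof -
    have "card (II i) \<le> nat \<lceil>M\<rceil>" for i using M[rule_format, of i] by linarith
    from NJI_imp_attractive[OF \<rho> c this] show ?thesis
      using UGAS_Gam_rho class_Kinf_scale[OF \<rho>, of "1/2"] by (metis half_gt_zero zero_less_one)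
  qed
  show ?thesis
  proof (rule conjI[OF ab], rule impI, rule iffI)
    assume "\<exists>\<sigma>. path_strict_decay II gam \<sigma>"
    with ab obtain \<rho> where \<rho>: "class_Kinf \<rho>" "UGAS (Gam_rho II gam \<rho>)" by blast
    show "\<exists>\<rho>. class_Kinf \<rho> \<and> bounded_trajectories (Gam_rho II gam \<rho>) \<and> uniform_NJI II (Gam_rho II gam \<rho>)"
      by (rule bc[OF \<rho>])
  next
    assume "assumption_A II gam \<and> (\<exists>M>0. \<forall>i. real (card (II i)) \<le> M)"
    then obtain M where M: "\<forall>i. real (card (II i)) \<le> M" by blast
    assume "\<exists>\<rho>. class_Kinf \<rho> \<and> bounded_trajectories (Gam_rho II gam \<rho>) \<and> uniform_NJI II (Gam_rho II gam \<rho>)"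
    then obtain \<rho> where \<rho>: "class_Kinf \<rho>" "bounded_trajectories (Gam_rho II gam \<rho>)" "uniform_NJI II (Gam_rho II gam \<rho>)"
      by blast
    show "\<exists>\<sigma>. path_strict_decay II gam \<sigma>"
      using cb[OF M \<rho>] ab by simp
  qed
qed

end
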